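(* Consider $N$ agents with linear dynamics $\dot x_i=A_ix_i+B_iu_i$, $y_i=C_ix_i$ ($i=1,\dots,N$), satisfying the standing assumptions (A1)–(A4) of the context, and let $y^*=(y_1^*,\dots,y_N^* )\in\mathcal Y$ be an optimal solution of the problem of minimizing $\int_0^T f(t,y)\,dt$ over $y\in\mathcal Y$ subject to $\sum_{i=1}^N g_i(t,y_i)\le \mathbf 0$ for all $t\in[0,T]$. Let $\varepsilon>0$, $\sigma>0$, $\iota>0$ and $K_\mu\ge NK_g$, and let every agent apply the event-triggered controller $$u_i=-K_{\alpha_i}x_i+K_{\beta_i}\,\Pi_{\mathcal Y_i}\big[y_i,-\varepsilon \mathcal H_i^{y_i}(t,y_i,\mu_i)\big],\qquad \dot\mu_i=\Pi_{\mathbb R_+^q}\Big[\mu_i,\ \varepsilon g_i(t,y_i)-2\varepsilon K_\mu\sum_{j=1}^N a_{ij}\,\mathrm{sgn}(\hat\mu_i-\hat\mu_j)\Big],\qquad \mu_i(0)=\mathbf 0,$$ where $\hat\mu_i(t)=\mu_i(t_i^l)$ for $t\in[t_i^l,t_i^{l+1})$, $e_i(t)=\hat\mu_i(t)-\mu_i(t)$, and the communication instants of agent $i$ are generated by $$t_i^{l+1}=\inf_{t>t_i^l}\Big\{t\ \Big|\ \|e_i(t)\|\ge \frac{1}{6N\sqrt q}\sum_{j=1}^N a_{ij}\|\hat\mu_i-\hat\mu_j\|_1+\frac{\sigma e^{-\iota t}}{3N^2K_\mu\sqrt q}\Big\}.$$ Then for any $T\ge 0$ the resulting output trajectory $y(t)=\mathrm{col}(y_1(t),\dots,y_N(t))$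 satisfies $$\mathcal R^T:=\int_0^T\big(f(t,y(t))-f(t,y^* )\big)\,dt\ \le\ \frac{\|y(0)-y^*\|^2}{2\varepsilon}+\frac{\sigma}{\iota}.$$
   Context: Agent $i$ has state $x_i\in\mathbb R^{n_i}$, input $u_i\in\mathbb R^{m_i}$, output $y_i\in\mathbb R^{p_i}$, with real matrices $A_i,B_i,C_i$ of compatible sizes; an output set $\mathcal Y_i\subseteq\mathbb R^{p_i}$; a cost function $f_i(t,\cdot):\mathbb R^{p_i}\to\mathbb R$; and a constraint function $g_i(t,\cdot):\mathbb R^{p_i}\to\mathbb R^q$ with components $g_{i,1},\dots,g_{i,q}$. Write $\mathcal Y=\mathcal Y_1\times\cdots\times\mathcal Y_N$, $y=\mathrm{col}(y_1,\dots,y_N)$ (stacked vector), $f(t,y)=\sum_{i=1}^N f_i(t,y_i)$. Norm $\|\cdot\|$ is Euclidean and $\|\cdot\|_1$ is the 1-norm; vector inequalities are componentwise; $\mathbb R^q_+$ is the nonnegative orthant. Standing assumptions. (A1) The communication graph on $\{1,\dots,N\}$ is undirected and connected; $a_{ij}=a_{ji}=1$ if $\{i,j\}$ is an edge and $a_{ij}=0$ otherwise. (A2) Each $\mathcal Y_i$ is convex and compact; for $t\in[0,T]$, $f_i(t,\cdot)$ and (componentwise) $g_i(t,\cdot)$ are convex and bounded on $\mathcal Y_i$ with $|f_i(t,y_i)|\le K_f$ and $\|g_i(t,y_i)\|\le K_g$ for constants $K_f,K_g>0$, and they are integrable in time (also along the trajectories considered). (A3) The set $\{y\in\mathcal Y:\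 \sum_{i=1}^N g_i(t,y_i)\le \mathbf 0\ \text{for all } t\in[0,T]\}$ is nonempty. (A4) $(A_i,B_i)$ is controllable and $\mathrm{rank}(C_iB_i)=p_i$ for each $i$. Feedback matrices: $K_{\alpha_i},K_{\beta_i}$ are any solutions of $C_iB_iK_{\alpha_i}=C_iA_i$ and $C_iB_iK_{\beta_i}=I_{p_i}$ (solutions exist by (A4)). Projection: for a closed convex set $\mathcal S\subseteq\mathbb R^n$, $x\in\mathcal S$, $v\in\mathbb R^n$, $\Pi_{\mathcal S}[x,v]=\lim_{\xi\to0^+}\frac{P_{\mathcal S}(x+\xi v)-x}{\xi}$, where $P_{\mathcal S}$ is Euclidean projection onto $\mathcal S$. Each agent has a multiplier $\mu_i\in\mathbb R^q_+$. $\mathcal H_i^{y_i}(t,y_i,\mu_i)$ denotes an element of $\partial f_i(t,y_i)+\sum_{k=1}^q\mu_{i,k}\,\partial g_{i,k}(t,y_i)$ (a subgradient in $y_i$ of the convex function $f_i(t,y_i)+\mu_i^\top g_i(t,y_i)$). In the event-triggered controller $\mathrm{sgn}$ acts componentwise with $\mathrm{sgn}(s)=-1,0,1$ for $s<0$, $s=0$, $s>0$ respectively. Communication: agent $i$ has communication instants $t_i^1<t_i^2<\cdots$ with $t_i^1=0$ (and $t_i^{l+1}=\infty$ if the triggering set is empty); $\hat\mu_i$ is the last broadcast value of $\mu_i$. Trajectories are absolutely continuous functions $(x_i,\mu_i)$ on $[0,T]$ satisfying the closed-loop equations for almost every $t$, with $y_i(t)\in\mathcal Y_i$ (in particular $y_i(0)\in\mathcal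 Y_i$) and $\mu_i(t)\in\mathbb R^q_+$. *)

theory Defs
  imports "HOL-Analysis.Analysis"
begin

text \<open>
  The dimensions of the agents may differ from agent to agent, whereas the dimension of
  \<^typ>\<open>real ^ 'n\<close> is fixed by the type. The Euclidean space of dimension d is therefore represented
  by \<open>coord_space I\<close> for an index set \<open>I\<close> with \<open>card I = d\<close>: the vectors whose entries outside
  \<open>I\<close> are padded with 0. Padding changes neither norms and inner products nor
  convexity, compactness, nearest points and ranks. Since the type \<open>'n\<close> and the sets are
  arbitrary, so are the dimensions.
\<close>

definition coord_space :: "'n set \<Rightarrow> (real ^ 'n) set" where
  "coord_space I = {x. \<forall>k. k \<notin> I \<longrightarrow> x $ k = 0}"

lemma dim_coord_space: "vec.dim (coord_space I) = card I"
  unfolding coord_space_def by (rule dim_substandard_cart)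

definition mat_space :: "'r set \<Rightarrow> 'c set \<Rightarrow> (real ^ 'c ^ 'r) set" where
  "mat_space I J = {M. \<forall>k l. k \<notin> I \<or> l \<notin> J \<longrightarrow> M $ k $ l = 0}"

definition id_mat :: "'n set \<Rightarrow> real ^ 'n ^ 'n" where
  "id_mat I = (\<chi> k l. if k = l \<and> k \<in> I then 1 else 0)"

definition abs_continuous :: "real \<Rightarrow> real \<Rightarrow> (real \<Rightarrow> 'a::real_normed_vector) \<Rightarrow> bool" where
  "abs_continuous a b h \<longleftrightarrow>
    (\<forall>\<epsilon>>0. \<exists>\<delta>>0. \<forall>D :: (real \<times> real) set.
      finite D \<and> (\<forall>(c, d)\<in>D. a \<le> c \<and> c \<le> d \<and> d \<le> b) \<and>
      disjoint_family_on (\<lambda>(c, d). {c<..<d}) D \<and> (\<Sum>(c, d)\<in>D. d - c) < \<delta>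
      \<longrightarrow> (\<Sum>(c, d)\<in>D. norm (h d - h c)) < \<epsilon>)"

definition controllable ::
  "'n::finite set \<Rightarrow> 'm::finite set \<Rightarrow> real ^ 'n ^ 'n \<Rightarrow> real ^ 'm ^ 'n \<Rightarrow> bool" where
  "controllable I J A B \<longleftrightarrow>
    (\<forall>x0\<in>coord_space I. \<forall>x1\<in>coord_space I. \<exists>\<tau>>0. \<exists>u x.
      (\<forall>t\<in>{0..\<tau>}. u t \<in> coord_space J \<and> x t \<in> coord_space I) \<and>
      u absolutely_integrable_on {0..\<tau>} \<and> abs_continuous 0 \<tau> x \<and> x 0 = x0 \<and> x \<tau> = x1 \<and>
      (AE t in lebesgue. t \<in> {0..\<tau>} \<longrightarrow>
        (x has_vector_derivative (A *v x t + B *v u t)) (at t within {0..\<tau>})))"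

definition dir_proj :: "'a::euclidean_space set \<Rightarrow> 'a \<Rightarrow> 'a \<Rightarrow> 'a" where
  "dir_proj S x v = Lim (at_right 0) (\<lambda>\<xi>. (closest_point S (x + \<xi> *\<^sub>R v) - x) /\<^sub>R \<xi>)"

definition nonneg_orthant :: "(real ^ 'q) set" where
  "nonneg_orthant = {v. 0 \<le> v}"

text \<open>The library's \<^const>\<open>sgn\<close> on vectors is normalisation, not the componentwise sign.\<close>

definition sgn_vec :: "real ^ 'q \<Rightarrow> real ^ 'q" where
  "sgn_vec v = (\<chi> k. sgn (v $ k))"

definition norm1 :: "real ^ 'q::finite \<Rightarrow> real" where
  "norm1 v = (\<Sum>k\<in>UNIV. \<bar>v $ k\<bar>)"

text \<open>
  Subgradients at \<open>y\<close>, in the space \<open>V\<close>, of a function that is convex on \<open>S\<close>. The subgradient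
  inequality is required on \<open>S\<close> only, so for a function that is convex on all of \<open>V\<close> this set
  also contains every subgradient in the usual global sense.
\<close>

definition subdiff :: "'a::real_inner set \<Rightarrow> 'a set \<Rightarrow> ('a \<Rightarrow> real) \<Rightarrow> 'a \<Rightarrow> 'a set" where
  "subdiff V S h y = {s \<in> V. \<forall>z\<in>S. h z \<ge> h y + s \<bullet> (z - y)}"

definition lagrangian_subdiff ::
  "'a::real_inner set \<Rightarrow> 'a set \<Rightarrow> ('a \<Rightarrow> real) \<Rightarrow> ('a \<Rightarrow> real ^ 'q::finite) \<Rightarrow> 'a \<Rightarrow> real ^ 'q \<Rightarrow> 'a set"
  where
  "lagrangian_subdiff V S h g y \<mu> =
    {s + (\<Sum>k\<in>UNIV. \<mu> $ k *\<^sub>R w k) | s w.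
      s \<in> subdiff V S h y \<and> (\<forall>k. w k \<in> subdiff V S (\<lambda>z. g z $ k) y)}"

definition adj :: "'N set set \<Rightarrow> 'N \<Rightarrow> 'N \<Rightarrow> real" where
  "adj E i j = (if {i, j} \<in> E then 1 else 0)"

definition connected_graph :: "'N set set \<Rightarrow> bool" where
  "connected_graph E \<longleftrightarrow> (\<forall>e\<in>E. card e = 2) \<and> (\<forall>i j. (\<lambda>a b. {a, b} \<in> E)\<^sup>*\<^sup>* i j)"

text \<open>
  A stacked vector \<open>col (y\<^sub>1, \<dots>, y\<^sub>N)\<close> is an element of \<^typ>\<open>real ^ 'p ^ 'N\<close>; its library norm is the
  Euclidean norm of the stacked vector.
\<close>

definition total_cost ::
  "('N::finite \<Rightarrow> real \<Rightarrow> real ^ 'p \<Rightarrow> real) \<Rightarrow> real \<Rightarrow> real ^ 'p ^ 'N \<Rightarrow> real" where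
  "total_cost f t y = (\<Sum>i\<in>UNIV. f i t (y $ i))"

definition feasible_set ::
  "real \<Rightarrow> ('N::finite \<Rightarrow> (real ^ 'p) set) \<Rightarrow> ('N \<Rightarrow> real \<Rightarrow> real ^ 'p \<Rightarrow> real ^ 'q)
    \<Rightarrow> (real ^ 'p ^ 'N) set" where
  "feasible_set T Y g =
    {y. (\<forall>i. y $ i \<in> Y i) \<and> (\<forall>t\<in>{0..T}. (\<Sum>i\<in>UNIV. g i t (y $ i)) \<le> 0)}"

definition optimal_solution ::
  "real \<Rightarrow> ('N::finite \<Rightarrow> (real ^ 'p) set) \<Rightarrow> ('N \<Rightarrow> real \<Rightarrow> real ^ 'p \<Rightarrow> real)
    \<Rightarrow> ('N \<Rightarrow> real \<Rightarrow> real ^ 'p \<Rightarrow> real ^ 'q) \<Rightarrow> real ^ 'p ^ 'N \<Rightarrow> bool" where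
  "optimal_solution T Y f g y \<longleftrightarrow>
    y \<in> feasible_set T Y g \<and>
    (\<forall>z\<in>feasible_set T Y g.
      integral {0..T} (\<lambda>t. total_cost f t y) \<le> integral {0..T} (\<lambda>t. total_cost f t z))"

text \<open>
  Here \<open>m\<close> is the value currently broadcast by agent \<open>i\<close> and \<open>muhat j t\<close> the one broadcast by
  agent \<open>j\<close> at time \<open>t\<close>.
\<close>

definition trigger_threshold ::
  "'N::finite set set \<Rightarrow> real \<Rightarrow> real \<Rightarrow> real \<Rightarrow> ('N \<Rightarrow> real \<Rightarrow> real ^ 'q::finite)
    \<Rightarrow> 'N \<Rightarrow> real ^ 'q \<Rightarrow> real \<Rightarrow> real" where
  "trigger_threshold E \<sigma> \<iota> K\<^sub>\<mu> muhat i m t =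
    1 / (6 * real CARD('N) * sqrt (real CARD('q))) * (\<Sum>j\<in>UNIV. adj E i j * norm1 (m - muhat j t))
    + \<sigma> * exp (- \<iota> * t) / (3 * (real CARD('N))\<^sup>2 * K\<^sub>\<mu> * sqrt (real CARD('q)))"

text \<open>
  \<open>tau i l\<close> is the communication instant number \<open>l + 1\<close> of agent \<open>i\<close>. In the triggering set agent
  \<open>i\<close>'s own broadcast value is held at the value sent at \<open>tau i l\<close>, because it is the value in
  force until the instant being defined. The infimum of the empty set of extended reals is
  \<open>\<infinity>\<close>.
\<close>

definition event_triggered ::
  "real \<Rightarrow> 'N::finite set set \<Rightarrow> real \<Rightarrow> real \<Rightarrow> real \<Rightarrow> ('N \<Rightarrow> real \<Rightarrow> real ^ 'q::finite)
    \<Rightarrow> ('N \<Rightarrow> real \<Rightarrow> real ^ 'q) \<Rightarrow> ('N \<Rightarrow> nat \<Rightarrow> ereal) \<Rightarrow> bool" where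
  "event_triggered T E \<sigma> \<iota> K\<^sub>\<mu> mu muhat tau \<longleftrightarrow>
    (\<forall>i. tau i 0 = 0 \<and>
      (\<forall>l. tau i (Suc l) =
        Inf {ereal t | t. tau i l < ereal t \<and> t \<le> T \<and>
          norm (mu i (real_of_ereal (tau i l)) - mu i t)
            \<ge> trigger_threshold E \<sigma> \<iota> K\<^sub>\<mu> muhat i (mu i (real_of_ereal (tau i l))) t}) \<and>
      (\<forall>l. \<forall>t\<in>{0..T}. tau i l \<le> ereal t \<and> ereal t < tau i (Suc l) \<longrightarrow>
        muhat i t = mu i (real_of_ereal (tau i l))))"

end

theory Submission
  imports Defs
begin

text \<open>
  The feedback linearises each agent to the projected gradient flow of its output, so the half squared
  distances of \<open>y\<close> to \<open>ystar\<close> and of the multipliers to 0 form a Lyapunov function whose derivative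
  is at most \<open>\<epsilon>\<close> times the negative instantaneous regret, plus the constraint term of \<open>ystar\<close>, minus
  the sign penalty on the disagreement of the broadcast multipliers. On a connected graph the
  constraint term is at most half the penalty coefficient times the true disagreement, because
  \<open>ystar\<close> is feasible and each pairwise distance is bounded by the disagreement. The discrepancy between
  true and broadcast multipliers is controlled by the trigger and leaves at most \<open>\<sigma> * exp (- \<iota> * t)\<close>;
  integrating in time gives the bound.
\<close>

subsection \<open>Projected directions\<close>

text \<open>\<open>dir_proj\<close> is defined through \<open>Lim\<close>, which is informative only
  once the limit exists. The quotient is the nearest point to \<open>v\<close> in
  \<open>(S - x) / \<xi>\<close>; by convexity these sets grow as \<xi> decreases to 0, and their
  union is the cone \<open>K\<close> of feasible directions. Hence the quotients converge to the
  projection of \<open>v\<close> onto the closure of \<open>K\<close>, the tangent cone of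
  \<open>S\<close> at \<open>x\<close>.\<close>

lemma dir_proj_tendsto:
  fixes S :: "'a::euclidean_space set"
  assumes S: "convex S" "closed S" and x: "x \<in> S"
  shows "((\<lambda>\<xi>. (closest_point S (x + \<xi> *\<^sub>R v) - x) /\<^sub>R \<xi>) \<longlongrightarrow> dir_proj S x v) (at_right 0)"
proof -
  define q where "q \<xi> = (closest_point S (x + \<xi> *\<^sub>R v) - x) /\<^sub>R \<xi>" for \<xi> :: real
  define K where "K = {k. \<exists>\<xi>>0. x + \<xi> *\<^sub>R k \<in> S}"
  have shrink: "x + \<xi> *\<^sub>R k \<in> S" if "x + \<xi>' *\<^sub>R k \<in> S" "0 < \<xi>" "\<xi> \<le> \<xi>'" for \<xi> \<xi>' k
  proof -
    have "(1 - \<xi> / \<xi>') *\<^sub>R x + (\<xi> / \<xi>') *\<^sub>R (x + \<xi>' *\<^sub>R k) \<in> S"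
      using that x by (intro convexD_alt[OF S(1)]) auto
    moreover have "(1 - \<xi> / \<xi>') *\<^sub>R x + (\<xi> / \<xi>') *\<^sub>R (x + \<xi>' *\<^sub>R k) = x + \<xi> *\<^sub>R k"
      using that by (simp add: algebra_simps)
    ultimately show ?thesis by simp
  qed
  have "convex K"
  proof (rule convexI)
    fix k1 k2 and a b :: real
    assume "k1 \<in> K" "k2 \<in> K" and ab: "0 \<le> a" "0 \<le> b" "a + b = 1"
    then obtain \<xi>1 \<xi>2 where k: "\<xi>1 > 0" "\<xi>2 > 0" "x + \<xi>1 *\<^sub>R k1 \<in> S" "x + \<xi>2 *\<^sub>R k2 \<in> S"
      by (auto simp: K_def)
    define \<xi> where "\<xi> = min \<xi>1 \<xi>2"
    have "\<xi> > 0" using k by (simp add: \<xi>_def)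
    have "a *\<^sub>R (x + \<xi> *\<^sub>R k1) + b *\<^sub>R (x + \<xi> *\<^sub>R k2) \<in> S"
      using k ab by (intro convexD[OF S(1)] shrink[OF k(3)] shrink[OF k(4)]) (auto simp: \<xi>_def)
    moreover have "a *\<^sub>R (x + \<xi> *\<^sub>R k1) + b *\<^sub>R (x + \<xi> *\<^sub>R k2)
        = (a + b) *\<^sub>R x + \<xi> *\<^sub>R (a *\<^sub>R k1 + b *\<^sub>R k2)"
      by (simp add: algebra_simps)
    ultimately show "a *\<^sub>R k1 + b *\<^sub>R k2 \<in> K"
      using \<open>\<xi> > 0\<close> ab by (auto simp: K_def)
  qed
  define w where "w = closest_point (closure K) v"
  have "0 \<in> K" using x by (auto simp: K_def intro: exI[of _ 1])
  then have w: "w \<in> closure K"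
    unfolding w_def by (intro closest_point_in_set) auto
  have in_S: "x + \<xi> *\<^sub>R q \<xi> \<in> S" if "\<xi> > 0" for \<xi>
    using that closest_point_in_set[OF S(2)] x by (auto simp: q_def)
  have nearest: "norm (v - q \<xi>) \<le> norm (v - k)" if "\<xi> > 0" "x + \<xi> *\<^sub>R k \<in> S" for \<xi> k
  proof -
    have "dist (x + \<xi> *\<^sub>R v) (x + \<xi> *\<^sub>R q \<xi>) \<le> dist (x + \<xi> *\<^sub>R v) (x + \<xi> *\<^sub>R k)"
      using closest_point_le[OF S(2) that(2), of "x + \<xi> *\<^sub>R v"] that(1) by (simp add: q_def)
    then have "norm (\<xi> *\<^sub>R (v - q \<xi>)) \<le> norm (\<xi> *\<^sub>R (v - k))"
      by (simp add: dist_norm scaleR_diff_right)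
    then show ?thesis using that(1) by simp
  qed
  \<comment> \<open>The angle at the projection \<open>w\<close> is not acute, so the excess of the
    squared distance from \<open>v\<close> over its minimum bounds the squared distance of
    \<open>q \<xi>\<close> from \<open>w\<close>. It then suffices that \<open>q \<xi>\<close> is
    nearly optimal.\<close>
  have pythagoras: "(norm (q \<xi> - w))\<^sup>2 \<le> (norm (v - q \<xi>))\<^sup>2 - (norm (v - w))\<^sup>2" if "\<xi> > 0" for \<xi>
  proof -
    have "q \<xi> \<in> closure K"
      using in_S[OF that] that closure_subset[of K] by (auto simp: K_def)
    then have "(v - w) \<bullet> (q \<xi> - w) \<le> 0"
      unfolding w_def using \<open>convex K\<close> by (intro closest_point_dot convex_closure) auto
    moreover have "(norm (v - q \<xi>))\<^sup>2
        = (norm (v - w))\<^sup>2 - 2 * ((v - w) \<bullet> (q \<xi> - w)) + (norm (q \<xi> - w))\<^sup>2"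
      by (simp add: power2_norm_eq_inner algebra_simps inner_commute)
    ultimately show ?thesis by simp
  qed
  have "(q \<longlongrightarrow> w) (at_right 0)"
  proof (rule tendstoI)
    fix e :: real assume "e > 0"
    define d where "d = norm (v - w)"
    \<comment> \<open>Chosen to give \<open>(d + \<eta>)\<^sup>2 < d\<^sup>2 + e\<^sup>2\<close>:
      the bound 1 yields \<open>\<eta> * \<eta> < \<eta> * 2\<close>, and the quotient yields
      \<open>\<eta> * (2 * d + 2) \<le> e\<^sup>2\<close>.\<close>
    define \<eta> where "\<eta> = min 1 (e\<^sup>2 / (2 * d + 2))"
    have "d \<ge> 0" by (simp add: d_def)
    have \<eta>: "\<eta> > 0" "\<eta> \<le> 1" using \<open>e > 0\<close> \<open>d \<ge> 0\<close> by (auto simp: \<eta>_def)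
    have "\<eta> * (2 * d + 2) \<le> e\<^sup>2"
      using \<open>d \<ge> 0\<close> unfolding \<eta>_def
      by (metis add_nonneg_pos min.cobounded2 mult_nonneg_nonneg pos_le_divide_eq zero_le_numeral zero_less_numeral)
    moreover have "\<eta> * \<eta> < \<eta> * 2" using \<eta> by (intro mult_strict_left_mono) auto
    moreover have "(d + \<eta>)\<^sup>2 = d\<^sup>2 + \<eta> * (2 * d + 2) + (\<eta> * \<eta> - \<eta> * 2)"
      by (simp add: power2_eq_square algebra_simps)
    ultimately have \<eta>3: "(d + \<eta>)\<^sup>2 < d\<^sup>2 + e\<^sup>2" by linarith
    \<comment> \<open>A feasible direction close to \<open>w\<close> is a competitor for
      \<open>q \<xi>\<close> as soon as \<xi> is below the step length \<open>\<xi>'\<close> that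
      \<open>k\<close> admits.\<close>
    obtain k where k: "k \<in> K" "dist k w < \<eta>"
      using w \<eta>(1) by (auto simp: closure_approachable)
    then obtain \<xi>' where \<xi>': "\<xi>' > 0" "x + \<xi>' *\<^sub>R k \<in> S" by (auto simp: K_def)
    have "dist (q \<xi>) w < e" if "0 < \<xi>" "\<xi> < \<xi>'" for \<xi>
    proof -
      have "norm (v - q \<xi>) \<le> norm (v - k)"
        using that \<xi>' by (intro nearest shrink[OF \<xi>'(2)]) auto
      also have "\<dots> \<le> d + \<eta>"
        using k(2) norm_triangle_ineq[of "v - w" "w - k"] by (simp add: d_def dist_norm norm_minus_commute)
      finally have "(norm (v - q \<xi>))\<^sup>2 \<le> (d + \<eta>)\<^sup>2"
        by (intro power_mono) auto
      then have "(norm (q \<xi> - w))\<^sup>2 < e\<^sup>2"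
        using pythagoras[OF that(1)] \<eta>3 by (simp add: d_def)
      then show ?thesis
        using \<open>e > 0\<close> by (simp add: dist_norm power2_less_imp_less)
    qed
    then show "\<forall>\<^sub>F \<xi> in at_right 0. dist (q \<xi>) w < e"
      using \<xi>'(1) by (auto simp: eventually_at_right_field)
  qed
  then have "dir_proj S x v = w"
    unfolding dir_proj_def q_def by (intro tendsto_Lim) auto
  with \<open>(q \<longlongrightarrow> w) (at_right 0)\<close> show ?thesis
    by (simp add: q_def[abs_def])
qed

text \<open>\<open>v - q \<xi>\<close> is a positive multiple of the residual of the projection,
  which makes no acute angle with \<open>z - p \<xi>\<close>; the inequality survives the limit,
  where \<open>p \<xi>\<close> tends to \<open>x\<close>. It lets the unprojected direction replace
  the projected one in the derivative of a squared distance.\<close>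

lemma dir_proj_inner_le:
  fixes S :: "'a::euclidean_space set"
  assumes S: "convex S" "closed S" and x: "x \<in> S" and z: "z \<in> S"
  shows "(x - z) \<bullet> dir_proj S x v \<le> (x - z) \<bullet> v"
proof -
  define p where "p \<xi> = closest_point S (x + \<xi> *\<^sub>R v)" for \<xi> :: real
  define q where "q \<xi> = (p \<xi> - x) /\<^sub>R \<xi>" for \<xi> :: real
  have q: "(q \<longlongrightarrow> dir_proj S x v) (at_right 0)"
    using dir_proj_tendsto[OF S x, of v] by (simp add: q_def[abs_def] p_def)
  have cont: "isCont (closest_point S) (x + 0 *\<^sub>R v)"
    using S x by (intro continuous_at_closest_point) auto
  have "((\<lambda>\<xi>. x + \<xi> *\<^sub>R v) \<longlongrightarrow> x + 0 *\<^sub>R v) (at_right 0)"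
    by (intro tendsto_intros)
  with cont have "((\<lambda>\<xi>. closest_point S (x + \<xi> *\<^sub>R v)) \<longlongrightarrow> closest_point S (x + 0 *\<^sub>R v)) (at_right 0)"
    by (rule isCont_tendsto_compose)
  then have "(p \<longlongrightarrow> x) (at_right 0)"
    using x by (simp add: p_def[abs_def] closest_point_self)
  then have "((\<lambda>\<xi>. (v - q \<xi>) \<bullet> (z - p \<xi>)) \<longlongrightarrow> (v - dir_proj S x v) \<bullet> (z - x)) (at_right 0)"
    using q by (intro tendsto_intros)
  moreover have "\<forall>\<^sub>F \<xi> in at_right 0. (v - q \<xi>) \<bullet> (z - p \<xi>) \<le> 0"
  proof -
    have "(v - q \<xi>) \<bullet> (z - p \<xi>) \<le> 0" if "\<xi> > 0" for \<xi>
    proof -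
      have "(x + \<xi> *\<^sub>R v - p \<xi>) \<bullet> (z - p \<xi>) \<le> 0"
        unfolding p_def by (rule closest_point_dot[OF S z])
      moreover have "x + \<xi> *\<^sub>R v - p \<xi> = \<xi> *\<^sub>R (v - q \<xi>)"
        using that by (simp add: q_def algebra_simps)
      ultimately show ?thesis using that by (simp add: mult_le_0_iff)
    qed
    then show ?thesis by (auto simp: eventually_at_right_field intro: exI[of _ 1])
  qed
  ultimately have "(v - dir_proj S x v) \<bullet> (z - x) \<le> 0"
    by (intro tendsto_upperbound) auto
  then show ?thesis by (simp add: algebra_simps inner_commute)
qed

lemma convex_nonneg_orthant: "convex (nonneg_orthant :: (real ^ 'q::finite) set)"
  by (auto simp: nonneg_orthant_def convex_def less_eq_vec_def)

lemma closed_nonneg_orthant: "closed (nonneg_orthant :: (real ^ 'q::finite) set)"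
proof -
  have eq: "nonneg_orthant = (\<Inter>k. {v :: real ^ 'q. 0 \<le> v $ k})"
    by (auto simp: nonneg_orthant_def less_eq_vec_def)
  show ?thesis
    unfolding eq by (intro closed_INT ballI closed_Collect_le continuous_intros)
qed

subsection \<open>Absolutely continuous functions\<close>

lemma abs_continuousE:
  assumes "abs_continuous a b h" "e > 0"
  obtains \<delta> where "\<delta> > 0"
    and "\<And>D. finite D \<Longrightarrow> (\<And>c d. (c, d) \<in> D \<Longrightarrow> a \<le> c \<and> c \<le> d \<and> d \<le> b) \<Longrightarrow>
      disjoint_family_on (\<lambda>(c, d). {c<..<d}) D \<Longrightarrow> (\<Sum>(c, d)\<in>D. d - c) < \<delta> \<Longrightarrow>
      (\<Sum>(c, d)\<in>D. norm (h d - h c)) < e"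
proof -
  from assms(1)[unfolded abs_continuous_def, THEN spec, THEN mp, OF assms(2)]
  obtain \<delta> where \<delta>: "\<delta> > 0" "\<forall>D. finite D \<and> (\<forall>(c, d)\<in>D. a \<le> c \<and> c \<le> d \<and> d \<le> b) \<and>
      disjoint_family_on (\<lambda>(c, d). {c<..<d}) D \<and> (\<Sum>(c, d)\<in>D. d - c) < \<delta> \<longrightarrow>
      (\<Sum>(c, d)\<in>D. norm (h d - h c)) < e"
    by (elim exE conjE)
  show thesis
  proof (rule that[OF \<delta>(1)])
    fix D :: "(real \<times> real) set"
    assume D: "finite D" "\<And>c d. (c, d) \<in> D \<Longrightarrow> a \<le> c \<and> c \<le> d \<and> d \<le> b"
      "disjoint_family_on (\<lambda>(c, d). {c<..<d}) D" "(\<Sum>(c, d)\<in>D. d - c) < \<delta>"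
    show "(\<Sum>(c, d)\<in>D. norm (h d - h c)) < e"
      by (rule \<delta>(2)[THEN spec, THEN mp]) (use D in blast)
  qed
qed

text \<open>A family consisting of a single interval already gives the modulus of
  continuity.\<close>

lemma abs_continuous_uniformly_continuous:
  assumes "abs_continuous a b h"
  shows "uniformly_continuous_on {a..b} h"
  unfolding uniformly_continuous_on_def
proof (intro allI impI)
  fix e :: real assume "e > 0"
  then obtain \<delta> where "\<delta> > 0" and \<delta>: "\<And>D. finite D \<Longrightarrow> (\<And>c d. (c, d) \<in> D \<Longrightarrow> a \<le> c \<and> c \<le> d \<and> d \<le> b) \<Longrightarrow>
      disjoint_family_on (\<lambda>(c, d). {c<..<d}) D \<Longrightarrow> (\<Sum>(c, d)\<in>D. d - c) < \<delta> \<Longrightarrow>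
      (\<Sum>(c, d)\<in>D. norm (h d - h c)) < e"
    using abs_continuousE[OF assms] by blast
  have step: "norm (h d - h c) < e" if "a \<le> c" "c \<le> d" "d \<le> b" "d - c < \<delta>" for c d
    using \<delta>[of "{(c, d)}"] that by (simp add: disjoint_family_on_def)
  have "dist (h t) (h s) < e" if "s \<in> {a..b}" "t \<in> {a..b}" "dist t s < \<delta>" for s t
    using that step[of s t] step[of t s]
    by (cases "s \<le> t") (auto simp: dist_norm norm_minus_commute abs_if split: if_splits)
  with \<open>\<delta> > 0\<close> show "\<exists>\<delta>>0. \<forall>s\<in>{a..b}. \<forall>t\<in>{a..b}. dist t s < \<delta> \<longrightarrow> dist (h t) (h s) < e"
    by blast
qed

lemma abs_continuous_lipschitz:
  assumes "abs_continuous a b h"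
    and lip: "\<And>s t. s \<in> {a..b} \<Longrightarrow> t \<in> {a..b} \<Longrightarrow> norm (G t - G s) \<le> M * norm (h t - h s)"
  shows "abs_continuous a b G"
  unfolding abs_continuous_def
proof (intro allI impI)
  fix e :: real assume "e > 0"
  \<comment> \<open>\<open>M\<close> may be zero or negative; the enlarged constant is positive, so
    \<open>e / M'\<close> is an admissible tolerance.\<close>
  define M' where "M' = \<bar>M\<bar> + 1"
  have "M' > 0" by (simp add: M'_def)
  have lip': "norm (G t - G s) \<le> M' * norm (h t - h s)" if "s \<in> {a..b}" "t \<in> {a..b}" for s t
    using order_trans[OF lip[OF that] mult_right_mono[of M M']] by (simp add: M'_def)
  from \<open>e > 0\<close> \<open>M' > 0\<close> have "e / M' > 0" by simp
  then obtain \<delta> where "\<delta> > 0" and \<delta>: "\<And>D. finite D \<Longrightarrow> (\<And>c d. (c, d) \<in> D \<Longrightarrow> a \<le> c \<and> c \<le> d \<and> d \<le> b) \<Longrightarrow>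
      disjoint_family_on (\<lambda>(c, d). {c<..<d}) D \<Longrightarrow> (\<Sum>(c, d)\<in>D. d - c) < \<delta> \<Longrightarrow>
      (\<Sum>(c, d)\<in>D. norm (h d - h c)) < e / M'"
    using abs_continuousE[OF assms(1)] by blast
  have "(\<Sum>(c, d)\<in>D. norm (G d - G c)) < e"
    if D: "finite D \<and> (\<forall>(c, d)\<in>D. a \<le> c \<and> c \<le> d \<and> d \<le> b) \<and>
      disjoint_family_on (\<lambda>(c, d). {c<..<d}) D \<and> (\<Sum>(c, d)\<in>D. d - c) < \<delta>" for D
  proof -
    have "(\<Sum>(c, d)\<in>D. norm (G d - G c)) \<le> (\<Sum>(c, d)\<in>D. M' * norm (h d - h c))"
      using D by (intro sum_mono) (auto intro!: lip' split: prod.splits)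
    also have "\<dots> = M' * (\<Sum>(c, d)\<in>D. norm (h d - h c))"
      by (simp add: sum_distrib_left case_prod_unfold)
    also have "\<dots> < M' * (e / M')"
      using D \<open>M' > 0\<close> by (intro mult_strict_left_mono \<delta>) auto
    finally show ?thesis using \<open>M' > 0\<close> by simp
  qed
  with \<open>\<delta> > 0\<close> show "\<exists>\<delta>>0. \<forall>D. finite D \<and> (\<forall>(c, d)\<in>D. a \<le> c \<and> c \<le> d \<and> d \<le> b) \<and>
      disjoint_family_on (\<lambda>(c, d). {c<..<d}) D \<and> (\<Sum>(c, d)\<in>D. d - c) < \<delta> \<longrightarrow>
      (\<Sum>(c, d)\<in>D. norm (G d - G c)) < e"
    by blast
qed

text \<open>By continuity \<open>h\<close> is bounded on the compact interval, and a squared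
  distance is Lipschitz on bounded sets.\<close>

lemma abs_continuous_norm_square:
  fixes h :: "real \<Rightarrow> 'a::real_inner"
  assumes "abs_continuous a b h"
  shows "abs_continuous a b (\<lambda>t. (norm (h t - c))\<^sup>2)"
proof -
  have "compact (h ` {a..b})"
    using abs_continuous_uniformly_continuous[OF assms]
    by (intro compact_continuous_image uniformly_continuous_imp_continuous) auto
  then have "bounded (h ` {a..b})" by (rule compact_imp_bounded)
  then obtain M where M: "\<And>t. t \<in> {a..b} \<Longrightarrow> norm (h t) \<le> M"
    unfolding bounded_iff by blast
  show ?thesis
  proof (rule abs_continuous_lipschitz[OF assms])
    fix s t assume st: "s \<in> {a..b}" "t \<in> {a..b}"
    have "(norm (h t - c))\<^sup>2 - (norm (h s - c))\<^sup>2
        = (norm (h t - c) + norm (h s - c)) * (norm (h t - c) - norm (h s - c))"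
      by (simp add: power2_eq_square algebra_simps)
    then have "norm ((norm (h t - c))\<^sup>2 - (norm (h s - c))\<^sup>2)
        = (norm (h t - c) + norm (h s - c)) * \<bar>norm (h t - c) - norm (h s - c)\<bar>"
      by (simp add: abs_mult)
    also have "\<dots> \<le> (2 * (M + norm c)) * norm (h t - h s)"
      using norm_triangle_ineq4[of "h t" c] norm_triangle_ineq4[of "h s" c] M[OF st(1)] M[OF st(2)]
        norm_triangle_ineq3[of "h t - c" "h s - c"]
        norm_ge_zero[of "h t"] norm_ge_zero[of c]
      by (intro mult_mono) (auto simp del: norm_ge_zero)
    finally show "norm ((norm (h t - c))\<^sup>2 - (norm (h s - c))\<^sup>2) \<le> (2 * (M + norm c)) * norm (h t - h s)" .
  qed
qed

text \<open>
  The gauge keeps the tags of the exceptional null set inside an open set of small measure, where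
  absolute continuity controls the increments, and uses differentiability at all other tags.
\<close>

lemma abs_continuous_has_integral_deriv:
  fixes h :: "real \<Rightarrow> 'a::real_normed_vector"
  assumes "a \<le> b" and ac: "abs_continuous a b h"
    and deriv: "AE t in lebesgue. t \<in> {a..b} \<longrightarrow> (h has_vector_derivative h' t) (at t within {a..b})"
  shows "(h' has_integral (h b - h a)) {a..b}"
proof -
  obtain N where N: "N \<in> null_sets lebesgue"
      "\<And>t. t \<notin> N \<Longrightarrow> t \<in> {a..b} \<Longrightarrow> (h has_vector_derivative h' t) (at t within {a..b})"
    using deriv by (fastforce simp: eventually_ae_filter)
  \<comment> \<open>With the value 0 on \<open>N\<close>, an exceptional tag contributes only an
    increment of \<open>h\<close>; the change on a null set does not affect the integral.\<close>
  define f where "f t = (if t \<in> N then 0 else h' t)" for t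
  have "(f has_integral (h b - h a)) {a..b}"
    unfolding has_integral_real
  proof (intro allI impI)
    fix e :: real assume "e > 0"
    define e1 where "e1 = e / (2 * (b - a + 1))"
    have "e1 > 0" using \<open>e > 0\<close> \<open>a \<le> b\<close> by (simp add: e1_def)
    have e1: "e1 * (b - a) < e / 2"
    proof -
      have "e1 * (b - a) < e1 * (b - a + 1)" using \<open>e1 > 0\<close> by simp
      also have "\<dots> = e / 2" using \<open>a \<le> b\<close> by (simp add: e1_def field_simps)
      finally show ?thesis .
    qed
    obtain \<delta> where "\<delta> > 0" and \<delta>: "\<And>D. finite D \<Longrightarrow> (\<And>c d. (c, d) \<in> D \<Longrightarrow> a \<le> c \<and> c \<le> d \<and> d \<le> b) \<Longrightarrow>
        disjoint_family_on (\<lambda>(c, d). {c<..<d}) D \<Longrightarrow> (\<Sum>(c, d)\<in>D. d - c) < \<delta> \<Longrightarrow>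
        (\<Sum>(c, d)\<in>D. norm (h d - h c)) < e / 2"
      using abs_continuousE[OF ac half_gt_zero[OF \<open>e > 0\<close>]] by blast
    \<comment> \<open>The outer approximation bounds only \<open>U - N\<close>; since
      \<open>N\<close> is null, \<open>U\<close> itself has measure below \<delta>.\<close>
    obtain U where U: "open U" "N \<subseteq> U" "U - N \<in> lmeasurable" "emeasure lebesgue (U - N) < ennreal \<delta>"
      using sets_lebesgue_outer_open[OF _ \<open>\<delta> > 0\<close>, of N] N(1) by blast
    have "U = (U - N) \<union> N" using U(2) by auto
    have U_emeasure: "emeasure lebesgue U < ennreal \<delta>"
      using U(4) N(1) \<open>U = (U - N) \<union> N\<close> U(3)
      by (metis emeasure_Un_null_set fmeasurableD)
    then have U_meas: "U \<in> lmeasurable" 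
      using U(1) by (intro fmeasurableI) (auto simp: order.strict_trans intro: lmeasurable_open)
    then have U_measure: "measure lebesgue U < \<delta>"
      using U_emeasure \<open>\<delta> > 0\<close> by (simp add: emeasure_eq_measure2 ennreal_less_iff)
    have "\<exists>d>0. t \<notin> N \<longrightarrow> t \<in> {a..b} \<longrightarrow> (\<forall>s\<in>{a..b}. norm (s - t) < d \<longrightarrow>
        norm (h s - h t - (s - t) *\<^sub>R h' t) \<le> e1 * norm (s - t))" for t
      using N(2)[of t] \<open>e1 > 0\<close> unfolding has_vector_derivative_def has_derivative_within_alt
      by (cases "t \<in> N \<or> t \<notin> {a..b}") (auto intro: exI[of _ 1])
    then obtain r where r: "\<And>t. r t > 0" and r': "\<And>t s. t \<notin> N \<Longrightarrow> t \<in> {a..b} \<Longrightarrow> s \<in> {a..b} \<Longrightarrow>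
        norm (s - t) < r t \<Longrightarrow> norm (h s - h t - (s - t) *\<^sub>R h' t) \<le> e1 * norm (s - t)"
      by metis
    define \<gamma> where "\<gamma> t = (if t \<in> N then U else ball t (r t))" for t
    have "gauge \<gamma>" using U r by (auto simp: gauge_def \<gamma>_def)
    moreover have "norm ((\<Sum>(t, K)\<in>p. measure lborel K *\<^sub>R f t) - (h b - h a)) < e"
      if p: "p tagged_division_of {a..b}" and fine: "\<gamma> fine p" for p
    proof -
      note tag = tagged_division_ofD[OF p]
      have "finite p" by (rule tag(1))
      have interval: "\<exists>c d. K = {c..d} \<and> a \<le> c \<and> c \<le> t \<and> t \<le> d \<and> d \<le> b" if tK: "(t, K) \<in> p" for t K
      proof -
        obtain c d where "K = cbox c d" using tag(4)[OF tK] by auto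
        moreover have "t \<in> K" "K \<subseteq> {a..b}" using tag(2,3)[OF tK] by auto
        ultimately show ?thesis by (auto intro!: exI[of _ c] exI[of _ d])
      qed
      define q where "q = {(t, K) \<in> p. t \<in> N}"
      have "q \<subseteq> p" by (auto simp: q_def)
      have "finite q" using \<open>finite p\<close> \<open>q \<subseteq> p\<close> by (rule rev_finite_subset)
      define F where "F = (\<lambda>(t, K). measure lborel K *\<^sub>R f t - (h (Sup K) - h (Inf K)))"
      have "(\<Sum>(t, K)\<in>p. measure lborel K *\<^sub>R f t) - (h b - h a) = sum F p"
        unfolding F_def using additive_tagged_division_1[OF \<open>a \<le> b\<close> p, of h]
        by (simp add: case_prod_unfold sum_subtractf)
      also have "\<dots> = sum F (p - q) + sum F q"
        using \<open>finite p\<close> \<open>q \<subseteq> p\<close> by (rule sum.subset_diff[rotated])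
      finally have split: "(\<Sum>(t, K)\<in>p. measure lborel K *\<^sub>R f t) - (h b - h a) = sum F (p - q) + sum F q" .
      have "norm (sum F (p - q)) \<le> (\<Sum>(t, K)\<in>p - q. e1 * (Sup K - Inf K))"
      proof (rule sum_norm_le, clarify)
        fix t K assume tK: "(t, K) \<in> p" "(t, K) \<notin> q"
        then have "t \<notin> N" by (auto simp: q_def)
        obtain c d where cd: "K = {c..d}" "a \<le> c" "c \<le> t" "t \<le> d" "d \<le> b"
          using interval[OF tK(1)] by auto
        have "K \<subseteq> ball t (r t)"
          using fineD[OF fine tK(1)] \<open>t \<notin> N\<close> by (simp add: \<gamma>_def)
        then have "c \<in> ball t (r t)" "d \<in> ball t (r t)"
          using cd by (auto simp: subset_iff)
        then have "norm (h d - h t - (d - t) *\<^sub>R h' t) \<le> e1 * norm (d - t)"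
            "norm (h c - h t - (c - t) *\<^sub>R h' t) \<le> e1 * norm (c - t)"
          using cd r'[OF \<open>t \<notin> N\<close>, of d] r'[OF \<open>t \<notin> N\<close>, of c] by (auto simp: dist_norm abs_minus_commute)
        \<comment> \<open>Splitting at the tag turns the error on the interval into two
          differentiability errors, one towards each endpoint, and the two partial lengths add up to
          the whole.\<close>
        moreover have "F (t, K) = (h c - h t - (c - t) *\<^sub>R h' t) - (h d - h t - (d - t) *\<^sub>R h' t)"
          using cd \<open>t \<notin> N\<close> by (simp add: F_def f_def algebra_simps)
        ultimately have "norm (F (t, K)) \<le> e1 * norm (c - t) + e1 * norm (d - t)"
          using norm_triangle_ineq4[of "h c - h t - (c - t) *\<^sub>R h' t" "h d - h t - (d - t) *\<^sub>R h' t"]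
          by simp
        also have "\<dots> = e1 * (Sup K - Inf K)"
          using cd by (simp add: algebra_simps)
        finally show "norm (F (t, K)) \<le> e1 * (Sup K - Inf K)" .
      qed
      also have "\<dots> \<le> (\<Sum>(t, K)\<in>p. e1 * (Sup K - Inf K))"
      proof (rule sum_mono2[OF \<open>finite p\<close>])
        fix u assume "u \<in> p - (p - q)"
        then obtain t K where u: "u = (t, K)" "(t, K) \<in> p" by (metis DiffD1 prod.collapse)
        from interval[OF u(2)] show "0 \<le> (case u of (t, K) \<Rightarrow> e1 * (Sup K - Inf K))"
          using \<open>e1 > 0\<close> u(1) by auto
      qed auto
      also have "\<dots> = e1 * (b - a)"
        using additive_tagged_division_1[OF \<open>a \<le> b\<close> p, of "\<lambda>t. t"]
        by (simp add: case_prod_unfold flip: sum_distrib_left)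
      finally have regular: "norm (sum F (p - q)) < e / 2" using e1 by linarith
      define \<K> where "\<K> = snd ` q"
      have "q tagged_partial_division_of {a..b}"
        using p \<open>q \<subseteq> p\<close> by (meson tagged_division_of_def tagged_partial_division_subset)
      then have \<K>: "\<K> division_of \<Union>\<K>"
        unfolding \<K>_def by (rule partial_division_of_tagged_division)
      have \<K>_interval: "\<exists>c d. K = {c..d} \<and> a \<le> c \<and> c \<le> d \<and> d \<le> b" if "K \<in> \<K>" for K
        using that interval \<open>q \<subseteq> p\<close> unfolding \<K>_def by fastforce
      have inj: "inj_on (\<lambda>K. (Inf K, Sup K)) \<K>"
      proof (rule inj_onI)
        fix K L assume "K \<in> \<K>" "L \<in> \<K>" "(Inf K, Sup K) = (Inf L, Sup L)"
        then show "K = L" using \<K>_interval[of K] \<K>_interval[of L] by auto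
      qed
      have "norm (sum F q) \<le> (\<Sum>(t, K)\<in>q. norm (h (Sup K) - h (Inf K)))"
        by (rule sum_norm_le) (auto simp: F_def q_def f_def norm_minus_commute)
      also have "\<dots> = (\<Sum>K\<in>\<K>. norm (h (Sup K) - h (Inf K)))"
        unfolding \<K>_def
      \<comment> \<open>Two tags can share an interval only if its interior is empty; it is then a
        single point and has zero increment.\<close>
      proof (subst sum.reindex_nontrivial)
        show "norm (h (Sup (snd u)) - h (Inf (snd u))) = 0"
          if uv_q: "u \<in> q" "v \<in> q" "u \<noteq> v" "snd u = snd v" for u v
        proof -
          obtain t t' K where uv: "u = (t, K)" "v = (t', K)"
            using uv_q(4) by (metis prod.collapse)
          then have tK: "(t, K) \<in> p" "(t', K) \<in> p" "(t, K) \<noteq> (t', K)"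
            using uv_q \<open>q \<subseteq> p\<close> by auto
          obtain c d where cd: "K = {c..d}" "c \<le> d" using interval[OF tK(1)] by auto
          have "interior K \<inter> interior K = {}" using tag(5)[OF tK] .
          then have "c = d" using cd by (auto simp: interior_atLeastAtMost_real)
          then show ?thesis using cd uv by simp
        qed
      qed (use \<open>finite q\<close> in \<open>auto simp: case_prod_unfold\<close>)
      also have "\<dots> = (\<Sum>(c, d)\<in>(\<lambda>K. (Inf K, Sup K)) ` \<K>. norm (h d - h c))"
        by (subst sum.reindex[OF inj]) simp
      also have "\<dots> < e / 2"
      proof (rule \<delta>)
        show "finite ((\<lambda>K. (Inf K, Sup K)) ` \<K>)"
          using \<open>finite q\<close> by (simp add: \<K>_def)
        show "a \<le> c \<and> c \<le> d \<and> d \<le> b" if "(c, d) \<in> (\<lambda>K. (Inf K, Sup K)) ` \<K>" for c d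
          using that \<K>_interval by fastforce
        show "disjoint_family_on (\<lambda>(c, d). {c<..<d}) ((\<lambda>K. (Inf K, Sup K)) ` \<K>)"
          unfolding disjoint_family_on_def
        proof (intro ballI impI)
          fix u v assume uv: "u \<in> (\<lambda>K. (Inf K, Sup K)) ` \<K>" "v \<in> (\<lambda>K. (Inf K, Sup K)) ` \<K>" "u \<noteq> v"
          then obtain K L where KL: "K \<in> \<K>" "L \<in> \<K>" "u = (Inf K, Sup K)" "v = (Inf L, Sup L)"
            by auto
          then have "K \<noteq> L" using uv(3) by auto
          have "interior K = {Inf K<..<Sup K}" "interior L = {Inf L<..<Sup L}"
            using \<K>_interval[OF KL(1)] \<K>_interval[OF KL(2)]
            by (auto simp: interior_atLeastAtMost_real)
          then show "(case u of (c, d) \<Rightarrow> {c<..<d}) \<inter> (case v of (c, d) \<Rightarrow> {c<..<d}) = {}"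
            using division_ofD(5)[OF \<K> KL(1,2) \<open>K \<noteq> L\<close>] KL(3,4) by simp
        qed
        \<comment> \<open>The intervals do not overlap, so their total length is the measure of
          their union, which the gauge confines to \<open>U\<close>.\<close>
        have "(\<Sum>(c, d)\<in>(\<lambda>K. (Inf K, Sup K)) ` \<K>. d - c) = (\<Sum>K\<in>\<K>. measure lebesgue K)"
          using \<K>_interval by (subst sum.reindex[OF inj]) (fastforce intro!: sum.cong)
        also have "\<dots> = measure lebesgue (\<Union>\<K>)"
          by (rule content_division[OF \<K>])
        also have "\<dots> \<le> measure lebesgue U"
        proof (rule measure_mono_fmeasurable[OF _ _ U_meas])
          show "\<Union>\<K> \<subseteq> U"
            using fineD[OF fine] by (fastforce simp: \<K>_def q_def \<gamma>_def)
          show "\<Union>\<K> \<in> sets lebesgue"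
            using lmeasurable_division[OF \<K>] by auto
        qed
        finally show "(\<Sum>(c, d)\<in>(\<lambda>K. (Inf K, Sup K)) ` \<K>. d - c) < \<delta>"
          using U_measure by linarith
      qed
      finally have exceptional: "norm (sum F q) < e / 2" .
      show ?thesis
        unfolding split using norm_triangle_ineq[of "sum F (p - q)" "sum F q"] regular exceptional
        by linarith
    qed
    ultimately show "\<exists>\<gamma>. gauge \<gamma> \<and> (\<forall>p. p tagged_division_of {a..b} \<and> \<gamma> fine p \<longrightarrow>
        norm ((\<Sum>(t, K)\<in>p. measure lborel K *\<^sub>R f t) - (h b - h a)) < e)"
      by (intro exI[of _ \<gamma>]) auto
  qed
  then show ?thesis
    using N(1) by (elim has_integral_spike[rotated 2]) (auto simp: f_def negligible_iff_null_sets)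
qed

text \<open>Overwriting \<open>f\<close> by \<open>g\<close> on the exceptional null set keeps its
  integral and makes the comparison pointwise.\<close>

lemma has_integral_le_AE:
  fixes f g :: "'a::euclidean_space \<Rightarrow> real"
  assumes "(f has_integral i) S" "(g has_integral j) S"
    and "AE x in lebesgue. x \<in> S \<longrightarrow> f x \<le> g x"
  shows "i \<le> j"
proof -
  obtain N where N: "N \<in> null_sets lebesgue" "\<And>x. x \<notin> N \<Longrightarrow> x \<in> S \<Longrightarrow> f x \<le> g x"
    using assms(3) by (fastforce simp: eventually_ae_filter)
  define f' where "f' x = (if x \<in> N then g x else f x)" for x
  have "(f' has_integral i) S"
    by (rule has_integral_spike[OF _ _ assms(1), of N]) (use N(1) in \<open>auto simp: f'_def negligible_iff_null_sets\<close>)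
  then show ?thesis
    using assms(2) by (rule has_integral_le) (use N(2) in \<open>auto simp: f'_def\<close>)
qed

section \<open>Integrating squared distances and the decaying trigger tolerance\<close>

lemma has_vector_derivative_norm_square:
  fixes h :: "real \<Rightarrow> 'a::real_inner"
  assumes "(h has_vector_derivative h') (at t within S)"
  shows "((\<lambda>t. (norm (h t - c))\<^sup>2) has_vector_derivative (2 * ((h t - c) \<bullet> h'))) (at t within S)"
  unfolding power2_norm_eq_inner has_vector_derivative_def
  by (rule has_derivative_eq_rhs, (rule derivative_intros assms[unfolded has_vector_derivative_def])+)
    (simp add: fun_eq_iff inner_commute algebra_simps)

text \<open>The energy identity behind the Lyapunov argument: \<open>c\<close> is the optimum for
  the outputs and 0 for the multipliers.\<close>

lemma abs_continuous_has_integral_norm_square: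
  fixes h :: "real \<Rightarrow> 'a::real_inner"
  assumes "a \<le> b" "abs_continuous a b h"
    and "AE t in lebesgue. t \<in> {a..b} \<longrightarrow> (h has_vector_derivative h' t) (at t within {a..b})"
  shows "((\<lambda>t. 2 * ((h t - c) \<bullet> h' t)) has_integral ((norm (h b - c))\<^sup>2 - (norm (h a - c))\<^sup>2)) {a..b}"
  using assms(3)
  by (intro abs_continuous_has_integral_deriv[OF assms(1) abs_continuous_norm_square[OF assms(2)]])
    (auto elim!: eventually_mono intro: has_vector_derivative_norm_square)

lemma abs_continuous_matrix_vector_mult:
  fixes M :: "real ^ 'n ^ 'm"
  assumes "abs_continuous a b h"
  shows "abs_continuous a b (\<lambda>t. M *v h t)"
proof (rule abs_continuous_lipschitz[OF assms])
  show "norm (M *v h t - M *v h s) \<le> onorm ((*v) M) * norm (h t - h s)" for s t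
    unfolding matrix_vector_mult_diff_distrib[symmetric]
    by (rule onorm[OF matrix_vector_mul_bounded_linear])
qed

lemma has_integral_exp_decay:
  fixes \<sigma> \<iota> T :: real
  assumes "0 \<le> T" "\<iota> \<noteq> 0"
  shows "((\<lambda>t. \<sigma> * exp (- \<iota> * t)) has_integral \<sigma> / \<iota> * (1 - exp (- \<iota> * T))) {0..T}"
proof -
  have "((\<lambda>t. \<sigma> * exp (- \<iota> * t)) has_integral
      (- \<sigma> / \<iota> * exp (- \<iota> * T)) - (- \<sigma> / \<iota> * exp (- \<iota> * 0))) {0..T}"
    using assms
    by (intro fundamental_theorem_of_calculus)
      (auto intro!: derivative_eq_intros simp flip: has_real_derivative_iff_has_vector_derivative)
  then show ?thesis by (simp add: algebra_simps)
qed

subsection \<open>Disagreement on a connected graph\<close>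

lemma adj_sym: "adj E i j = adj E j i"
  by (simp add: adj_def insert_commute)

lemma adj_nonneg: "0 \<le> adj E i j"
  and adj_le_1: "adj E i j \<le> 1"
  by (simp_all add: adj_def)

text \<open>Instead of following a path from \<open>i\<close> to \<open>k\<close>, a vertex set
  \<open>S\<close> containing \<open>i\<close> is grown along edges. \<open>W S\<close> counts every
  edge inside \<open>S\<close> in both orders, so adding an endpoint \<open>b\<close> of an edge
  from \<open>a\<close> in \<open>S\<close> raises it by at least \<open>2 * d a b\<close>, which
  pays for the triangle inequality through \<open>a\<close>. A maximal such \<open>S\<close> must be
  the whole vertex set.\<close>

lemma connected_graph_dist_le:
  fixes d :: "'N::finite \<Rightarrow> 'N \<Rightarrow> real"
  assumes E: "connected_graph E"
    and d: "\<And>i j. 0 \<le> d i j" "\<And>i. d i i = 0" "\<And>i j. d i j = d j i"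
      "\<And>i j k. d i k \<le> d i j + d j k"
  shows "2 * d i k \<le> (\<Sum>a\<in>UNIV. \<Sum>b\<in>UNIV. adj E a b * d a b)"
proof -
  define W where "W S = (\<Sum>a\<in>S. \<Sum>b\<in>S. adj E a b * d a b)" for S
  have term_nonneg: "0 \<le> adj E a b * d a b" for a b
    using d(1) by (simp add: adj_nonneg)
  define P where "P S \<longleftrightarrow> i \<in> S \<and> (\<forall>k\<in>S. 2 * d i k \<le> W S)" for S
  have "P {i}"
    using d(2) by (simp add: P_def W_def)
  then obtain S where S: "P S" and maximal: "\<And>S'. P S' \<Longrightarrow> S \<subseteq> S' \<Longrightarrow> S' = S"
    using finite_has_maximal[of "{S. P S}"] by auto
  have "S = UNIV"
  proof (rule ccontr)
    assume "S \<noteq> UNIV"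
    then obtain m where "m \<notin> S" by auto
    \<comment> \<open>If no edge left \<open>S\<close>, everything reachable from \<open>i\<close>
      would stay in \<open>S\<close>, against connectivity.\<close>
    have "\<exists>a\<in>S. \<exists>b. b \<notin> S \<and> {a, b} \<in> E"
    proof (rule ccontr)
      assume no_edge: "\<not> ?thesis"
      have "(\<lambda>a b. {a, b} \<in> E)\<^sup>*\<^sup>* i m"
        using E by (simp add: connected_graph_def)
      then have "m \<in> S"
        by (induction rule: rtranclp_induct) (use S no_edge in \<open>auto simp: P_def\<close>)
      with \<open>m \<notin> S\<close> show False by simp
    qed
    then obtain a b where ab: "a \<in> S" "b \<notin> S" "{a, b} \<in> E" by auto
    \<comment> \<open>The new pairs appear in both orders; the diagonal pair vanishes because
      \<open>d b b = 0\<close>.\<close>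
    have "W (insert b S) = W S + (\<Sum>j\<in>S. adj E b j * d b j) + (\<Sum>j\<in>S. adj E j b * d j b)"
      using ab(2) d(2) by (simp add: W_def sum.distrib)
    moreover have "adj E b a * d b a \<le> (\<Sum>j\<in>S. adj E b j * d b j)"
      using ab(1) term_nonneg by (intro member_le_sum) auto
    moreover have "adj E a b * d a b \<le> (\<Sum>j\<in>S. adj E j b * d j b)"
      using ab(1) term_nonneg by (intro member_le_sum[of a S "\<lambda>j. adj E j b * d j b"]) auto
    moreover have "adj E a b = 1" "adj E b a = 1"
      using ab(3) by (simp_all add: adj_def insert_commute)
    moreover have "d b a = d a b" by (rule d(3))
    ultimately have W: "W S + 2 * d a b \<le> W (insert b S)" by simp
    have "2 * d i b \<le> W S + 2 * d a b"
      using S ab(1) d(4)[of i b a] by (auto simp: P_def)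
    then have "P (insert b S)"
      using S W d(1)[of a b] by (fastforce simp: P_def)
    with maximal[of "insert b S"] ab(2) show False by auto
  qed
  with S show ?thesis by (simp add: P_def W_def)
qed

section \<open>The 1-norm, the componentwise sign and the sign penalty\<close>

lemma norm1_nonneg: "0 \<le> norm1 v"
  by (simp add: norm1_def sum_nonneg)

lemma norm1_minus_commute: "norm1 (v - w) = norm1 (w - v)"
  by (simp add: norm1_def abs_minus_commute)

lemma norm1_triangle: "norm1 (u + v) \<le> norm1 u + norm1 v"
  unfolding norm1_def vector_add_component
  by (simp add: abs_triangle_ineq flip: sum.distrib) (intro sum_mono abs_triangle_ineq)

lemma norm_le_norm1: "norm v \<le> norm1 v"
  unfolding norm1_def by (rule norm_le_l1_cart)

text \<open>The sign vector attains the duality between the 1-norm and the maximum norm;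
  \<open>inner_sgn_vec_le\<close> is the matching upper bound for an arbitrary sign vector.\<close>

lemma inner_sgn_vec_self: "v \<bullet> sgn_vec v = norm1 v"
  by (simp add: inner_vec_def sgn_vec_def norm1_def abs_sgn)

lemma inner_sgn_vec_le: "v \<bullet> sgn_vec w \<le> norm1 v"
  unfolding inner_vec_def sgn_vec_def norm1_def
  by (intro sum_mono) (auto simp: sgn_if)

text \<open>Cauchy-Schwarz against \<open>sgn_vec v\<close>, whose entries have modulus at most 1.
  The factor is what the square roots in the trigger threshold compensate.\<close>

lemma norm1_le_norm:
  fixes v :: "real ^ 'q::finite"
  shows "norm1 v \<le> sqrt (real CARD('q)) * norm v"
proof -
  have "(norm (sgn_vec v))\<^sup>2 = (\<Sum>k\<in>UNIV. (sgn (v $ k))\<^sup>2)"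
    unfolding power2_norm_eq_inner inner_vec_def by (simp add: sgn_vec_def power2_eq_square)
  also have "\<dots> \<le> (\<Sum>k\<in>(UNIV::'q set). 1)"
    by (intro sum_mono) (auto simp: sgn_if)
  finally have "norm (sgn_vec v) \<le> sqrt (real CARD('q))"
    by (simp add: real_le_rsqrt)
  then have "norm v * norm (sgn_vec v) \<le> norm v * sqrt (real CARD('q))"
    by (intro mult_left_mono) auto
  then show ?thesis
    using Cauchy_Schwarz_ineq2[of v "sgn_vec v"] inner_sgn_vec_self[of v] by (simp add: mult.commute)
qed

lemma sgn_vec_minus_commute: "sgn_vec (v - w) = - sgn_vec (w - v)"
  by (simp add: sgn_vec_def vec_eq_iff flip: sgn_minus)

text \<open>Ordered pairs are summed, so each edge counts twice; this is the origin of the factors 2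
  and 1/2 below.\<close>

definition disagreement :: "'N::finite set set \<Rightarrow> ('N \<Rightarrow> real ^ 'q::finite) \<Rightarrow> real" where
  "disagreement E m = (\<Sum>i\<in>UNIV. \<Sum>j\<in>UNIV. adj E i j * norm1 (m i - m j))"

lemma norm1_diff_le_disagreement:
  assumes "connected_graph E"
  shows "2 * norm1 (m i - m k) \<le> disagreement E m"
  unfolding disagreement_def
proof (rule connected_graph_dist_le[OF assms])
  show "norm1 (m i - m k) \<le> norm1 (m i - m j) + norm1 (m j - m k)" for i j k
    using norm1_triangle[of "m i - m j" "m j - m k"] by simp
qed (simp_all add: norm1_nonneg norm1_minus_commute, simp add: norm1_def)

text \<open>Subtracting one common multiplier \<open>m k\<close> from all others can only increase
  the sum, since \<open>m k\<close> is nonnegative and the summed constraint nonpositive. The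
  remaining differences \<open>m i - m k\<close> are each at most half the disagreement.\<close>

lemma sum_multiplier_constraint_le:
  fixes m G :: "'N::finite \<Rightarrow> real ^ 'q::finite"
  assumes E: "connected_graph E" and m: "\<And>i. 0 \<le> m i"
    and G: "(\<Sum>i\<in>UNIV. G i) \<le> 0" "\<And>i. norm (G i) \<le> c"
  shows "(\<Sum>i\<in>UNIV. m i \<bullet> G i) \<le> real CARD('N) * c / 2 * disagreement E m"
proof -
  \<comment> \<open>Any agent can serve as the reference; its bound also yields
    \<open>0 \<le> c\<close>.\<close>
  obtain k :: 'N where True by simp
  have c: "0 \<le> c" using G(2)[of k] norm_ge_zero[of "G k"] by linarith
  have "m k \<bullet> (\<Sum>i\<in>UNIV. G i) \<le> 0"
    unfolding inner_vec_def using m[of k] G(1)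
    by (intro sum_nonpos) (auto simp: less_eq_vec_def intro!: mult_nonneg_nonpos)
  then have "(\<Sum>i\<in>UNIV. m i \<bullet> G i) \<le> (\<Sum>i\<in>UNIV. (m i - m k) \<bullet> G i)"
    by (simp add: inner_diff_left sum_subtractf inner_sum_right)
  also have "\<dots> \<le> (\<Sum>i\<in>(UNIV::'N set). disagreement E m / 2 * c)"
  proof (rule sum_mono)
    fix i
    have "(m i - m k) \<bullet> G i \<le> norm (m i - m k) * norm (G i)"
      by (rule norm_cauchy_schwarz)
    also have "\<dots> \<le> disagreement E m / 2 * c"
      using norm_le_norm1[of "m i - m k"] norm1_diff_le_disagreement[OF E, of m i k] G(2)[of i]
        norm_ge_zero[of "m i - m k"]
      by (intro mult_mono norm_ge_zero) linarith+
    finally show "(m i - m k) \<bullet> G i \<le> disagreement E m / 2 * c" .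
  qed
  finally show ?thesis by (simp add: mult_ac)
qed

text \<open>The adjacency is symmetric and the sign odd, so exchanging \<open>i\<close> and
  \<open>j\<close> pairs each term with its negative counterpart and leaves differences of
  multipliers.\<close>

lemma sum_sgn_vec_symmetrize:
  fixes m h :: "'N::finite \<Rightarrow> real ^ 'q::finite"
  shows "2 * (\<Sum>i\<in>UNIV. m i \<bullet> (\<Sum>j\<in>UNIV. adj E i j *\<^sub>R sgn_vec (h i - h j)))
    = (\<Sum>i\<in>UNIV. \<Sum>j\<in>UNIV. adj E i j * ((m i - m j) \<bullet> sgn_vec (h i - h j)))"
proof -
  define s where "s i j = adj E i j * (m i \<bullet> sgn_vec (h i - h j))" for i j
  have "(\<Sum>i\<in>UNIV. \<Sum>j\<in>UNIV. adj E i j * ((m i - m j) \<bullet> sgn_vec (h i - h j)))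
      = (\<Sum>i\<in>UNIV. \<Sum>j\<in>UNIV. s i j + s j i)"
  proof (intro sum.cong refl)
    fix i j
    show "adj E i j * ((m i - m j) \<bullet> sgn_vec (h i - h j)) = s i j + s j i"
      by (simp add: s_def adj_sym[of E j i] sgn_vec_minus_commute[of "h j" "h i"] algebra_simps)
  qed
  also have "\<dots> = (\<Sum>i\<in>UNIV. \<Sum>j\<in>UNIV. s i j) + (\<Sum>i\<in>UNIV. \<Sum>j\<in>UNIV. s j i)"
    by (simp add: sum.distrib)
  also have "(\<Sum>i\<in>UNIV. \<Sum>j\<in>UNIV. s j i) = (\<Sum>i\<in>UNIV. \<Sum>j\<in>UNIV. s i j)"
    by (rule sum.swap)
  finally show ?thesis
    by (simp add: s_def inner_sum_right)
qed

text \<open>The weights are at most 1 and each \<open>c i\<close> occurs \<open>CARD('N)\<close>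
  times in each of the two positions. With \<open>c\<close> the broadcast errors, this is the price
  of exchanging true and broadcast values on all edges.\<close>

lemma sum_adj_add_le:
  fixes c :: "'N::finite \<Rightarrow> real"
  assumes "\<And>i. 0 \<le> c i"
  shows "(\<Sum>i\<in>UNIV. \<Sum>j\<in>UNIV. adj E i j * (c i + c j)) \<le> 2 * real CARD('N) * (\<Sum>i\<in>UNIV. c i)"
proof -
  have "(\<Sum>i\<in>UNIV. \<Sum>j\<in>UNIV. adj E i j * (c i + c j))
      \<le> (\<Sum>i\<in>(UNIV::'N set). \<Sum>j\<in>(UNIV::'N set). c i + c j)"
    using assms adj_le_1 by (intro sum_mono mult_left_le_one_le) (auto simp: adj_nonneg)
  also have "\<dots> = 2 * real CARD('N) * (\<Sum>i\<in>UNIV. c i)"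
    by (simp add: sum.distrib sum_distrib_left mult.assoc)
  finally show ?thesis .
qed

text \<open>
  The penalty dominates the constraint term when evaluated at the broadcast values; each of the two
  passages between \<open>m\<close> and \<open>h\<close> costs a multiple of the broadcast errors, and the trigger threshold
  is calibrated to absorb exactly \<open>3 * K * CARD('N) * sqrt (CARD('q))\<close> times their sum.
\<close>

lemma penalty_dominates:
  fixes m h G :: "'N::finite \<Rightarrow> real ^ 'q::finite"
  assumes E: "connected_graph E" and m: "\<And>i. 0 \<le> m i"
    and G: "(\<Sum>i\<in>UNIV. G i) \<le> 0" "\<And>i. norm (G i) \<le> c"
    and K: "K \<ge> real CARD('N) * c" "K > 0"
    and err: "\<And>i. norm (h i - m i)
      \<le> 1 / (6 * real CARD('N) * sqrt (real CARD('q))) * (\<Sum>j\<in>UNIV. adj E i j * norm1 (h i - h j))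
        + s / (3 * (real CARD('N))\<^sup>2 * K * sqrt (real CARD('q)))"
  shows "(\<Sum>i\<in>UNIV. m i \<bullet> G i)
      - 2 * K * (\<Sum>i\<in>UNIV. m i \<bullet> (\<Sum>j\<in>UNIV. adj E i j *\<^sub>R sgn_vec (h i - h j))) \<le> s"
proof -
  define n where "n = real CARD('N)"
  define r where "r = sqrt (real CARD('q))"
  define a where "a i = norm1 (h i - m i)" for i
  have pos: "n > 0" "r > 0" by (simp_all add: n_def r_def)
  have D_nonneg: "0 \<le> disagreement E m"
    unfolding disagreement_def by (intro sum_nonneg mult_nonneg_nonneg adj_nonneg norm1_nonneg)
  \<comment> \<open>Passing to the 1-norm costs the factor \<open>r\<close>, which cancels against
    the threshold. Summing over the \<open>n\<close> agents and multiplying by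
    \<open>3 * K * n\<close> turns the two threshold terms into
    \<open>K / 2 * disagreement E h\<close> and \<open>s\<close>.\<close>
  have sum_a: "3 * K * n * (\<Sum>i\<in>UNIV. a i) \<le> K / 2 * disagreement E h + s"
  proof -
    have "(\<Sum>i\<in>UNIV. a i) \<le> (\<Sum>i\<in>UNIV. 1 / (6 * n) * (\<Sum>j\<in>UNIV. adj E i j * norm1 (h i - h j))
        + s / (3 * n\<^sup>2 * K))"
    proof (rule sum_mono)
      fix i
      have "a i \<le> r * norm (h i - m i)"
        unfolding a_def r_def by (rule norm1_le_norm)
      also have "\<dots> \<le> r * (1 / (6 * n * r) * (\<Sum>j\<in>UNIV. adj E i j * norm1 (h i - h j))
          + s / (3 * n\<^sup>2 * K * r))"
        using err[of i] pos by (intro mult_left_mono) (auto simp: n_def r_def)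
      also have "\<dots> = 1 / (6 * n) * (\<Sum>j\<in>UNIV. adj E i j * norm1 (h i - h j)) + s / (3 * n\<^sup>2 * K)"
        using pos by (simp add: distrib_left)
      finally show "a i \<le> \<dots>" .
    qed
    also have "\<dots> = 1 / (6 * n) * disagreement E h + n * (s / (3 * n\<^sup>2 * K))"
      by (simp add: sum.distrib disagreement_def sum_distrib_left n_def)
    finally have "3 * K * n * (\<Sum>i\<in>UNIV. a i)
        \<le> 3 * K * n * (1 / (6 * n) * disagreement E h + n * (s / (3 * n\<^sup>2 * K)))"
      using pos K(2) by (intro mult_left_mono) auto
    also have "\<dots> = K / 2 * disagreement E h + s"
      using pos K(2) by (simp add: field_simps power2_eq_square)
    finally show ?thesis .
  qed
  have diff: "norm1 ((h i - m i) - (h j - m j)) \<le> a i + a j" for i j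
    using norm1_triangle[of "h i - m i" "m j - h j"] norm1_minus_commute[of "m j" "h j"]
    by (simp add: a_def algebra_simps)
  have a_nonneg: "0 \<le> a i" for i by (simp add: a_def norm1_nonneg)
  have adj_sum: "(\<Sum>i\<in>UNIV. \<Sum>j\<in>UNIV. adj E i j * (a i + a j)) \<le> 2 * n * (\<Sum>i\<in>UNIV. a i)"
    unfolding n_def by (rule sum_adj_add_le[OF a_nonneg])
  \<comment> \<open>First passage: replacing \<open>m\<close> by \<open>h\<close> in the
    disagreement costs \<open>2 * n\<close> times the summed errors, later weighted by
    \<open>K / 2\<close>.\<close>
  have D: "disagreement E m \<le> disagreement E h + 2 * n * (\<Sum>i\<in>UNIV. a i)"
  proof -
    have "disagreement E m
        \<le> (\<Sum>i\<in>UNIV. \<Sum>j\<in>UNIV. adj E i j * norm1 (h i - h j) + adj E i j * (a i + a j))"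
      unfolding disagreement_def distrib_left[symmetric]
    proof (intro sum_mono mult_left_mono adj_nonneg)
      fix i j
      show "norm1 (m i - m j) \<le> norm1 (h i - h j) + (a i + a j)"
        using norm1_triangle[of "h i - h j" "(h j - m j) - (h i - m i)"] diff[of j i]
        by (simp add: algebra_simps)
    qed
    also have "\<dots> = disagreement E h + (\<Sum>i\<in>UNIV. \<Sum>j\<in>UNIV. adj E i j * (a i + a j))"
      by (simp add: disagreement_def sum.distrib)
    finally show ?thesis using adj_sum by linarith
  qed
  \<comment> \<open>Second passage: testing the sign of \<open>h i - h j\<close> against
    \<open>m i - m j\<close> instead loses the same amount, later weighted by
    \<open>K\<close>.\<close>
  have "disagreement E h
      \<le> (\<Sum>i\<in>UNIV. \<Sum>j\<in>UNIV. adj E i j * ((m i - m j) \<bullet> sgn_vec (h i - h j)) + adj E i j * (a i + a j))"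
    unfolding disagreement_def distrib_left[symmetric]
  proof (intro sum_mono mult_left_mono adj_nonneg)
    fix i j
    have "norm1 (h i - h j) = (m i - m j) \<bullet> sgn_vec (h i - h j)
        + ((h i - m i) - (h j - m j)) \<bullet> sgn_vec (h i - h j)"
      unfolding inner_sgn_vec_self[symmetric] inner_add_left[symmetric] by simp
    then show "norm1 (h i - h j) \<le> (m i - m j) \<bullet> sgn_vec (h i - h j) + (a i + a j)"
      using inner_sgn_vec_le[of "(h i - m i) - (h j - m j)" "h i - h j"] diff[of i j] by linarith
  qed
  also have "\<dots> = 2 * (\<Sum>i\<in>UNIV. m i \<bullet> (\<Sum>j\<in>UNIV. adj E i j *\<^sub>R sgn_vec (h i - h j)))
      + (\<Sum>i\<in>UNIV. \<Sum>j\<in>UNIV. adj E i j * (a i + a j))"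
    unfolding sum_sgn_vec_symmetrize by (simp add: sum.distrib)
  finally have "disagreement E h - 2 * n * (\<Sum>i\<in>UNIV. a i)
      \<le> 2 * (\<Sum>i\<in>UNIV. m i \<bullet> (\<Sum>j\<in>UNIV. adj E i j *\<^sub>R sgn_vec (h i - h j)))"
    using adj_sum by linarith
  then have penalty: "K * (disagreement E h - 2 * n * (\<Sum>i\<in>UNIV. a i))
      \<le> K * (2 * (\<Sum>i\<in>UNIV. m i \<bullet> (\<Sum>j\<in>UNIV. adj E i j *\<^sub>R sgn_vec (h i - h j))))"
    using K(2) by (intro mult_left_mono) auto
  have "(\<Sum>i\<in>UNIV. m i \<bullet> G i) \<le> n * c / 2 * disagreement E m"
    unfolding n_def by (rule sum_multiplier_constraint_le[OF E m G])
  also have "\<dots> \<le> K / 2 * disagreement E m"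
    using K(1) D_nonneg by (intro mult_right_mono) (auto simp: n_def)
  also have "\<dots> \<le> K / 2 * (disagreement E h + 2 * n * (\<Sum>i\<in>UNIV. a i))"
    using D K(2) by (intro mult_left_mono) auto
  \<comment> \<open>The two costs total \<open>3 * K * n\<close> times the summed errors. Half of
    the penalty cancels the constraint term; by \<open>sum_a\<close> the other half absorbs these
    costs up to \<open>s\<close>.\<close>
  finally show ?thesis
    using penalty sum_a by (simp add: algebra_simps)
qed

subsection \<open>Event-triggered broadcasts\<close>

text \<open>The disagreement part is nonnegative and the decaying part is smallest at
  \<open>T\<close>. A positive lower bound that is uniform in time is what keeps the communication
  instants apart.\<close>

lemma trigger_threshold_ge:
  fixes muhat :: "'N::finite \<Rightarrow> real \<Rightarrow> real ^ 'q::finite"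
  assumes "\<sigma> > 0" "\<iota> > 0" "K > 0" "t \<le> T"
  shows "\<sigma> * exp (- \<iota> * T) / (3 * (real CARD('N))\<^sup>2 * K * sqrt (real CARD('q)))
    \<le> trigger_threshold E \<sigma> \<iota> K muhat i m t"
proof -
  have "0 \<le> 1 / (6 * real CARD('N) * sqrt (real CARD('q)))
      * (\<Sum>j\<in>UNIV. adj E i j * norm1 (m - muhat j t))"
    by (intro mult_nonneg_nonneg sum_nonneg adj_nonneg norm1_nonneg) auto
  moreover have "\<sigma> * exp (- \<iota> * T) / (3 * (real CARD('N))\<^sup>2 * K * sqrt (real CARD('q)))
      \<le> \<sigma> * exp (- \<iota> * t) / (3 * (real CARD('N))\<^sup>2 * K * sqrt (real CARD('q)))"
    using assms by (intro divide_right_mono mult_left_mono) auto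
  ultimately show ?thesis by (simp add: trigger_threshold_def)
qed

text \<open>
  Beyond an accumulation point of the communication instants the broadcast value would be
  unconstrained; uniform continuity of the multiplier bounds the gaps between instants below.
\<close>

lemma event_triggered_error_le:
  fixes mu muhat :: "'N::finite \<Rightarrow> real \<Rightarrow> real ^ 'q::finite"
  assumes ev: "event_triggered T E \<sigma> \<iota> K mu muhat tau"
    and cont: "uniformly_continuous_on {0..T} (mu i)"
    and pos: "\<sigma> > 0" "\<iota> > 0" "K > 0"
    and t: "t \<in> {0..T}"
  shows "norm (muhat i t - mu i t) \<le> trigger_threshold E \<sigma> \<iota> K muhat i (muhat i t) t"
proof -
  define c where "c = \<sigma> * exp (- \<iota> * T) / (3 * (real CARD('N))\<^sup>2 * K * sqrt (real CARD('q)))"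
  have "c > 0" using pos by (simp add: c_def)
  define \<theta> where "\<theta> = trigger_threshold E \<sigma> \<iota> K muhat i"
  have \<theta>: "c \<le> \<theta> m s" if "s \<le> T" for m s
    unfolding c_def \<theta>_def using pos that by (rule trigger_threshold_ge)
  define Z where "Z l = {s. tau i l < ereal s \<and> s \<le> T \<and>
    norm (mu i (real_of_ereal (tau i l)) - mu i s) \<ge> \<theta> (mu i (real_of_ereal (tau i l))) s}" for l
  note ev_i = ev[unfolded event_triggered_def, THEN spec, of i]
  have tau_0: "tau i 0 = 0"
    using ev_i by (rule conjunct1)
  have "ereal ` Z l = {ereal s | s. tau i l < ereal s \<and> s \<le> T \<and>
      norm (mu i (real_of_ereal (tau i l)) - mu i s) \<ge> \<theta> (mu i (real_of_ereal (tau i l))) s}" for l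
    unfolding Z_def by (rule image_Collect)
  then have tau_Suc: "tau i (Suc l) = Inf (ereal ` Z l)" for l
    using ev_i[THEN conjunct2, THEN conjunct1, THEN spec, of l] by (simp only: \<theta>_def)
  have hold: "muhat i t = mu i (real_of_ereal (tau i l))" if "tau i l \<le> ereal t" "ereal t < tau i (Suc l)" for l
    using ev_i[THEN conjunct2, THEN conjunct2, THEN spec, of l, THEN bspec, OF t] that by simp
  have "tau i l \<le> tau i (Suc l)" for l
    unfolding tau_Suc by (rule Inf_greatest) (auto simp: Z_def)
  then have tau_nonneg: "0 \<le> tau i l" for l
    by (induction l) (auto simp: tau_0 intro: order_trans)
  obtain \<delta> where "\<delta> > 0" and \<delta>: "\<And>r s. r \<in> {0..T} \<Longrightarrow> s \<in> {0..T} \<Longrightarrow> dist s r < \<delta> \<Longrightarrow>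
      dist (mu i s) (mu i r) < c"
    using cont \<open>c > 0\<close> unfolding uniformly_continuous_on_def by metis
  \<comment> \<open>At a triggering time the multiplier has moved by at least \<open>c\<close> since
    the last instant, which takes at least the time \<delta>.\<close>
  have gap: "tau i l + ereal \<delta> \<le> tau i (Suc l)" if le: "tau i l \<le> ereal t" for l
    unfolding tau_Suc
  proof (rule Inf_greatest, clarify)
    fix s assume s: "s \<in> Z l"
    obtain r where r: "tau i l = ereal r" "0 \<le> r" "r \<le> t"
      using le tau_nonneg[of l] by (cases "tau i l") auto
    have "r < s" "s \<le> T" "\<theta> (mu i r) s \<le> norm (mu i r - mu i s)"
      using s by (auto simp: Z_def r)
    then have "\<not> dist s r < \<delta>"
      using \<delta>[of r s] \<theta>[of s "mu i r"] r t by (auto simp: dist_norm norm_minus_commute)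
    then show "tau i l + ereal \<delta> \<le> ereal s"
      using \<open>r < s\<close> by (simp add: r dist_norm)
  qed
  \<comment> \<open>If all instants were at most \<open>t\<close>, the gaps would force
    \<open>tau i l\<close> to be at least \<open>real l * \<delta>\<close>, which is
    unbounded.\<close>
  have "\<exists>l. ereal t < tau i l"
  proof (rule ccontr)
    assume "\<not> ?thesis"
    then have le: "tau i l \<le> ereal t" for l by (auto simp: not_less)
    have lower: "ereal (real l * \<delta>) \<le> tau i l" for l
    proof (induction l)
      case (Suc l)
      have "ereal (real (Suc l) * \<delta>) = ereal (real l * \<delta>) + ereal \<delta>"
        by (simp add: algebra_simps)
      also have "\<dots> \<le> tau i l + ereal \<delta>" using Suc by (rule add_right_mono)
      also have "\<dots> \<le> tau i (Suc l)" using gap[OF le] .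
      finally show ?case .
    qed (simp add: tau_0)
    obtain l where "t < real l * \<delta>" using reals_Archimedean3[OF \<open>\<delta> > 0\<close>] by blast
    with order_trans[OF lower[of l] le[of l]] show False by simp
  qed
  then obtain k where k: "tau i k \<le> ereal t" "ereal t < tau i (Suc k)"
  proof -
    assume *: "\<And>k. tau i k \<le> ereal t \<Longrightarrow> ereal t < tau i (Suc k) \<Longrightarrow> thesis"
    \<comment> \<open>The first instant after \<open>t\<close>. It is not number 0, since
      \<open>tau i 0 = 0\<close>, so its predecessor \<open>k\<close> is the instant in force at
      \<open>t\<close>.\<close>
    define l where "l = (LEAST l. ereal t < tau i l)"
    have l: "ereal t < tau i l"
      unfolding l_def using \<open>\<exists>l. ereal t < tau i l\<close> by (rule LeastI_ex)
    then obtain k where "l = Suc k" using t by (cases l) (auto simp: tau_0)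
    moreover have "\<not> ereal t < tau i k"
      using not_less_Least[of k "\<lambda>l. ereal t < tau i l"] \<open>l = Suc k\<close> by (simp add: l_def)
    ultimately show thesis using *[of k] l by (simp add: not_less)
  qed
  obtain r where r: "tau i k = ereal r" "0 \<le> r" "r \<le> t"
    using k(1) tau_nonneg[of k] by (cases "tau i k") auto
  have muhat: "muhat i t = mu i r" using hold[OF k] by (simp add: r)
  show ?thesis
  \<comment> \<open>The triggering set contains only times after \<open>r\<close>. At
    \<open>r = t\<close> the error is 0 and the threshold positive; a later \<open>t\<close> lies
    before the infimum and hence does not trigger.\<close>
  proof (cases "r = t")
    case True
    then show ?thesis using \<theta>[of t] t \<open>c > 0\<close> muhat by (auto simp: \<theta>_def intro: order_trans[OF less_imp_le])
  next
    case False
    have "t \<notin> Z k"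
      using k(2) unfolding tau_Suc by (meson Inf_lower imageI leD)
    then have "norm (mu i r - mu i t) < \<theta> (mu i r) t"
      using False r t by (auto simp: Z_def)
    then show ?thesis by (simp add: muhat \<theta>_def)
  qed
qed

subsection \<open>Regret bound\<close>

text \<open>Nonnegative multipliers preserve the direction when the subgradient inequalities of the
  components of \<open>g\<close> are added to that of \<open>h\<close>.\<close>

lemma lagrangian_subdiff_le:
  assumes H: "H \<in> lagrangian_subdiff V S h g y \<mu>" and "z \<in> S" "0 \<le> \<mu>"
  shows "H \<bullet> (z - y) \<le> h z - h y + \<mu> \<bullet> (g z - g y)"
proof -
  obtain s w where sw: "H = s + (\<Sum>k\<in>UNIV. \<mu> $ k *\<^sub>R w k)" "s \<in> subdiff V S h y"
      "\<And>k. w k \<in> subdiff V S (\<lambda>z. g z $ k) y"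
    using H by (auto simp: lagrangian_subdiff_def)
  have "s \<bullet> (z - y) \<le> h z - h y"
    using sw(2) \<open>z \<in> S\<close> by (auto simp: subdiff_def algebra_simps)
  moreover have "(\<Sum>k\<in>UNIV. \<mu> $ k * (w k \<bullet> (z - y))) \<le> \<mu> \<bullet> (g z - g y)"
    unfolding inner_vec_def inner_real_def vector_minus_component
  proof (intro sum_mono mult_left_mono)
    fix k
    show "w k \<bullet> (z - y) \<le> g z $ k - g y $ k"
      using sw(3)[of k] \<open>z \<in> S\<close> by (auto simp: subdiff_def algebra_simps)
    show "0 \<le> \<mu> $ k" using \<open>0 \<le> \<mu>\<close> by (simp add: less_eq_vec_def)
  qed
  ultimately show ?thesis
    by (simp add: sw(1) inner_add_left inner_sum_left)
qed

text \<open>\<open>id_mat I\<close> only deletes coordinates outside \<open>I\<close>, where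
  \<open>v\<close> vanishes. The padded identity produced by the feedback thus acts as a true
  identity when tested against output differences.\<close>

lemma inner_id_mat:
  fixes v :: "real ^ 'n::finite"
  assumes "v \<in> coord_space I"
  shows "v \<bullet> (id_mat I *v p) = v \<bullet> p"
proof -
  have "(id_mat I *v p) $ k = (if k \<in> I then p $ k else 0)" for k
    by (simp add: id_mat_def matrix_vector_mult_def if_distrib[of "\<lambda>x. x * _"] cong: if_cong)
  then show ?thesis
    unfolding inner_vec_def using assms by (intro sum.cong) (auto simp: coord_space_def)
qed

text \<open>\<open>Ka\<close> cancels the drift seen through the output, and \<open>Kb\<close> makes
  the output velocity equal to the commanded direction up to \<open>D\<close>.\<close>

lemma feedback_linearisation:
  fixes A :: "real ^ 'n::finite ^ 'n" and B :: "real ^ 'm::finite ^ 'n" and C :: "real ^ 'n ^ 'p::finite"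
  assumes "C ** B ** Ka = C ** A" "C ** B ** Kb = D"
  shows "C *v (A *v x + B *v (- (Ka *v x) + Kb *v p)) = D *v p"
proof -
  have "C *v (A *v x + B *v (- (Ka *v x) + Kb *v p))
      = (C ** A) *v x - (C ** B ** Ka) *v x + (C ** B ** Kb) *v p"
    by (simp add: matrix_vector_right_distrib matrix_vector_mult_diff_distrib
        matrix_vector_mul_assoc matrix_mul_assoc)
  then show ?thesis by (simp add: assms)
qed

lemma norm_square_vec:
  fixes v :: "'a::real_inner ^ 'n::finite"
  shows "(norm v)\<^sup>2 = (\<Sum>i\<in>UNIV. (norm (v $ i))\<^sup>2)"
  by (simp add: power2_norm_eq_inner inner_vec_def)

theorem theorem3:
  fixes T \<epsilon> \<sigma> \<iota> K\<^sub>f K\<^sub>g K\<^sub>\<mu> :: real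
    and E :: "'N::finite set set"
    and SX :: "'N \<Rightarrow> 'n::finite set" and SU :: "'N \<Rightarrow> 'm::finite set" and SY :: "'N \<Rightarrow> 'p::finite set"
    and A :: "'N \<Rightarrow> real ^ 'n ^ 'n" and B :: "'N \<Rightarrow> real ^ 'm ^ 'n" and C :: "'N \<Rightarrow> real ^ 'n ^ 'p"
    and K\<^sub>\<alpha> :: "'N \<Rightarrow> real ^ 'n ^ 'm" and K\<^sub>\<beta> :: "'N \<Rightarrow> real ^ 'p ^ 'm"
    and Y :: "'N \<Rightarrow> (real ^ 'p) set"
    and f :: "'N \<Rightarrow> real \<Rightarrow> real ^ 'p \<Rightarrow> real"
    and g :: "'N \<Rightarrow> real \<Rightarrow> real ^ 'p \<Rightarrow> real ^ 'q::finite"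
    and H :: "'N \<Rightarrow> real \<Rightarrow> real ^ 'p \<Rightarrow> real ^ 'q \<Rightarrow> real ^ 'p"
    and x :: "'N \<Rightarrow> real \<Rightarrow> real ^ 'n" and u :: "'N \<Rightarrow> real \<Rightarrow> real ^ 'm"
    and y :: "real \<Rightarrow> real ^ 'p ^ 'N" and ystar :: "real ^ 'p ^ 'N"
    and mu muhat :: "'N \<Rightarrow> real \<Rightarrow> real ^ 'q"
    and tau :: "'N \<Rightarrow> nat \<Rightarrow> ereal"
  assumes params: "T \<ge> 0" "\<epsilon> > 0" "\<sigma> > 0" "\<iota> > 0" "K\<^sub>f > 0" "K\<^sub>g > 0" "K\<^sub>\<mu> \<ge> real CARD('N) * K\<^sub>g"
    and matrices: "\<And>i. A i \<in> mat_space (SX i) (SX i)" "\<And>i. B i \<in> mat_space (SX i) (SU i)"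
      "\<And>i. C i \<in> mat_space (SY i) (SX i)"
    and graph: "connected_graph E"
    and output_sets: "\<And>i. Y i \<subseteq> coord_space (SY i)" "\<And>i. convex (Y i)" "\<And>i. compact (Y i)"
    and convexity: "\<And>i t. t \<in> {0..T} \<Longrightarrow> convex_on (Y i) (f i t)"
      "\<And>i t k. t \<in> {0..T} \<Longrightarrow> convex_on (Y i) (\<lambda>z. g i t z $ k)"
    and bounds: "\<And>i t z. t \<in> {0..T} \<Longrightarrow> z \<in> Y i \<Longrightarrow> \<bar>f i t z\<bar> \<le> K\<^sub>f"
      "\<And>i t z. t \<in> {0..T} \<Longrightarrow> z \<in> Y i \<Longrightarrow> norm (g i t z) \<le> K\<^sub>g"
    and integrability: "\<And>i z. z \<in> Y i \<Longrightarrow> (\<lambda>t. f i t z) absolutely_integrable_on {0..T}"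
      "\<And>i z. z \<in> Y i \<Longrightarrow> (\<lambda>t. g i t z) absolutely_integrable_on {0..T}"
      "\<And>i. (\<lambda>t. f i t (y t $ i)) absolutely_integrable_on {0..T}"
      "\<And>i. (\<lambda>t. g i t (y t $ i)) absolutely_integrable_on {0..T}"
    and feasible: "feasible_set T Y g \<noteq> {}"
    and controllability: "\<And>i. controllable (SX i) (SU i) (A i) (B i)"
    and full_rank: "\<And>i. rank (C i ** B i) = card (SY i)"
    and feedback: "\<And>i. K\<^sub>\<alpha> i \<in> mat_space (SU i) (SX i)" "\<And>i. K\<^sub>\<beta> i \<in> mat_space (SU i) (SY i)"
      "\<And>i. C i ** B i ** K\<^sub>\<alpha> i = C i ** A i" "\<And>i. C i ** B i ** K\<^sub>\<beta> i = id_mat (SY i)"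
    and optimal: "optimal_solution T Y f g ystar"
    and trajectory: "\<And>i. abs_continuous 0 T (x i)" "\<And>i. abs_continuous 0 T (mu i)"
      "\<And>i t. t \<in> {0..T} \<Longrightarrow> x i t \<in> coord_space (SX i)"
      "\<And>i t. t \<in> {0..T} \<Longrightarrow> y t $ i = C i *v x i t"
      "\<And>i t. t \<in> {0..T} \<Longrightarrow> y t $ i \<in> Y i"
      "\<And>i t. t \<in> {0..T} \<Longrightarrow> mu i t \<in> nonneg_orthant"
      "\<And>i. mu i 0 = 0"
    and plant: "\<And>i. AE t in lebesgue. t \<in> {0..T} \<longrightarrow>
      (x i has_vector_derivative (A i *v x i t + B i *v u i t)) (at t within {0..T})"
    and subgradient: "\<And>i. AE t in lebesgue. t \<in> {0..T} \<longrightarrow>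
      H i t (y t $ i) (mu i t)
        \<in> lagrangian_subdiff (coord_space (SY i)) (Y i) (f i t) (g i t) (y t $ i) (mu i t)"
    and input: "\<And>i. AE t in lebesgue. t \<in> {0..T} \<longrightarrow>
      u i t = - (K\<^sub>\<alpha> i *v x i t)
        + K\<^sub>\<beta> i *v dir_proj (Y i) (y t $ i) (- \<epsilon> *\<^sub>R H i t (y t $ i) (mu i t))"
    and multiplier: "\<And>i. AE t in lebesgue. t \<in> {0..T} \<longrightarrow>
      (mu i has_vector_derivative
        dir_proj nonneg_orthant (mu i t)
          (\<epsilon> *\<^sub>R g i t (y t $ i)
            - (2 * \<epsilon> * K\<^sub>\<mu>) *\<^sub>R (\<Sum>j\<in>UNIV. adj E i j *\<^sub>R sgn_vec (muhat i t - muhat j t))))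
        (at t within {0..T})"
    and events: "event_triggered T E \<sigma> \<iota> K\<^sub>\<mu> mu muhat tau"
  shows "integral {0..T} (\<lambda>t. total_cost f t (y t) - total_cost f t ystar)
    \<le> (norm (y 0 - ystar))\<^sup>2 / (2 * \<epsilon>) + \<sigma> / \<iota>"
proof -
  \<comment> \<open>Agrees with the components of \<open>y\<close> on \<open>{0..T}\<close>, but is
    a linear image of the state at every time, so its regularity and derivative come directly from
    the plant.\<close>
  define X where "X i t = C i *v x i t" for i t
  define DX where "DX i t = C i *v (A i *v x i t + B i *v u i t)" for i t
  define W where "W i t = \<epsilon> *\<^sub>R g i t (y t $ i)
    - (2 * \<epsilon> * K\<^sub>\<mu>) *\<^sub>R (\<Sum>j\<in>UNIV. adj E i j *\<^sub>R sgn_vec (muhat i t - muhat j t))" for i t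
  define Dmu where "Dmu i t = dir_proj nonneg_orthant (mu i t) (W i t)" for i t
  define F where "F t = total_cost f t (y t) - total_cost f t ystar" for t
  have "real CARD('N) * K\<^sub>g > 0" using params(6) by simp
  then have K: "K\<^sub>\<mu> > 0" using params(7) by linarith
  have X: "y t $ i = X i t" if "t \<in> {0..T}" for i t
    using trajectory(4)[OF that] by (simp add: X_def)
  have feas: "ystar \<in> feasible_set T Y g"
    using optimal by (simp add: optimal_solution_def)
  then have ystar: "ystar $ i \<in> Y i" for i
    by (simp add: feasible_set_def)
  have F_integral: "(F has_integral integral {0..T} F) {0..T}"
    unfolding F_def total_cost_def sum_subtractf[symmetric]
    by (intro integrable_integral integrable_sum integrable_diff set_lebesgue_integral_eq_integral(1)
        integrability(1,3) ystar) auto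
  have X_integral: "((\<lambda>t. 2 * ((X i t - ystar $ i) \<bullet> DX i t)) has_integral
      (norm (X i T - ystar $ i))\<^sup>2 - (norm (X i 0 - ystar $ i))\<^sup>2) {0..T}" for i
  proof (rule abs_continuous_has_integral_norm_square[OF params(1)])
    show "abs_continuous 0 T (X i)"
      unfolding X_def using trajectory(1) by (rule abs_continuous_matrix_vector_mult)
    show "AE t in lebesgue. t \<in> {0..T} \<longrightarrow> (X i has_vector_derivative DX i t) (at t within {0..T})"
      using plant[of i] unfolding X_def DX_def
      by (auto elim!: eventually_mono
          intro: bounded_linear.has_vector_derivative[OF matrix_vector_mul_bounded_linear])
  qed
  have mu_integral: "((\<lambda>t. 2 * ((mu i t - 0) \<bullet> Dmu i t)) has_integral
      (norm (mu i T - 0))\<^sup>2 - (norm (mu i 0 - 0))\<^sup>2) {0..T}" for i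
    using multiplier[of i] unfolding Dmu_def W_def
    by (rule abs_continuous_has_integral_norm_square[OF params(1) trajectory(2)])
  \<comment> \<open>The sum over \<open>2 * \<epsilon>\<close> is the derivative of the Lyapunov
    function divided by \<epsilon>.\<close>
  have "AE t in lebesgue. t \<in> {0..T} \<longrightarrow>
      F t + (\<Sum>i\<in>UNIV. 2 * ((X i t - ystar $ i) \<bullet> DX i t) + 2 * ((mu i t - 0) \<bullet> Dmu i t)) / (2 * \<epsilon>)
        \<le> \<sigma> * exp (- \<iota> * t)"
  proof -
    \<comment> \<open>There are finitely many agents, so one null set serves all of them.\<close>
    have "AE t in lebesgue. \<forall>i\<in>UNIV. t \<in> {0..T} \<longrightarrow>
        H i t (y t $ i) (mu i t)
          \<in> lagrangian_subdiff (coord_space (SY i)) (Y i) (f i t) (g i t) (y t $ i) (mu i t)"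
      using subgradient by (intro AE_finite_allI) auto
    moreover have "AE t in lebesgue. \<forall>i\<in>UNIV. t \<in> {0..T} \<longrightarrow>
        u i t = - (K\<^sub>\<alpha> i *v x i t)
          + K\<^sub>\<beta> i *v dir_proj (Y i) (y t $ i) (- \<epsilon> *\<^sub>R H i t (y t $ i) (mu i t))"
      using input by (intro AE_finite_allI) auto
    ultimately show ?thesis
    proof eventually_elim
      case (elim t)
      show ?case
      proof
        assume t: "t \<in> {0..T}"
        define pen where "pen i = mu i t \<bullet> (\<Sum>j\<in>UNIV. adj E i j *\<^sub>R sgn_vec (muhat i t - muhat j t))" for i
        have mu_nonneg: "0 \<le> mu i t" for i
          using trajectory(6)[OF t] by (simp add: nonneg_orthant_def)
        have agent: "(X i t - ystar $ i) \<bullet> DX i t + mu i t \<bullet> Dmu i t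
          \<le> \<epsilon> * ((f i t (ystar $ i) - f i t (y t $ i) + mu i t \<bullet> g i t (ystar $ i)) - 2 * K\<^sub>\<mu> * pen i)" for i
        proof -
          define h where "h = H i t (y t $ i) (mu i t)"
          define d where "d = dir_proj (Y i) (y t $ i) (- \<epsilon> *\<^sub>R h)"
          have "y t $ i \<in> coord_space (SY i)" "ystar $ i \<in> coord_space (SY i)"
            using trajectory(5)[OF t] ystar output_sets(1) by blast+
          then have coord: "y t $ i - ystar $ i \<in> coord_space (SY i)"
            by (simp add: coord_space_def)
          have "u i t = - (K\<^sub>\<alpha> i *v x i t) + K\<^sub>\<beta> i *v d"
            using elim(2) t by (simp add: d_def h_def)
          then have "DX i t = id_mat (SY i) *v d"
            unfolding DX_def by (simp only: feedback_linearisation[OF feedback(3,4)])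
          then have "(X i t - ystar $ i) \<bullet> DX i t = (y t $ i - ystar $ i) \<bullet> d"
            by (simp add: X[OF t, symmetric] inner_id_mat[OF coord])
          also have "\<dots> \<le> (y t $ i - ystar $ i) \<bullet> (- \<epsilon> *\<^sub>R h)"
            unfolding d_def using output_sets(2,3) trajectory(5)[OF t] ystar
            by (intro dir_proj_inner_le compact_imp_closed)
          also have "\<dots> = \<epsilon> * (h \<bullet> (ystar $ i - y t $ i))"
            by (simp add: algebra_simps inner_commute)
          also have "\<dots> \<le> \<epsilon> * (f i t (ystar $ i) - f i t (y t $ i)
              + mu i t \<bullet> (g i t (ystar $ i) - g i t (y t $ i)))"
            using elim(1) t params(2) ystar mu_nonneg unfolding h_def
            by (intro mult_left_mono lagrangian_subdiff_le) auto
          finally have primal: "(X i t - ystar $ i) \<bullet> DX i t \<le> \<dots>" .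
          \<comment> \<open>The comparison point is 0, which lies in the orthant.\<close>
          have "(mu i t - 0) \<bullet> Dmu i t \<le> (mu i t - 0) \<bullet> W i t"
            unfolding Dmu_def
            by (intro dir_proj_inner_le convex_nonneg_orthant closed_nonneg_orthant trajectory(6)[OF t])
              (simp add: nonneg_orthant_def)
          also have "\<dots> = \<epsilon> * (mu i t \<bullet> g i t (y t $ i) - 2 * K\<^sub>\<mu> * pen i)"
            by (simp add: W_def pen_def inner_diff_right algebra_simps)
          finally have "mu i t \<bullet> Dmu i t \<le> \<epsilon> * (mu i t \<bullet> g i t (y t $ i) - 2 * K\<^sub>\<mu> * pen i)"
            by simp
          \<comment> \<open>The terms \<open>mu i t \<bullet> g i t (y t $ i)\<close> of the primal
            and dual estimates cancel, leaving only the constraint at \<open>ystar\<close>.\<close>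
          with primal show ?thesis by (simp add: algebra_simps)
        qed
        \<comment> \<open>Feasibility of \<open>ystar\<close> makes the summed constraint
          nonpositive, and the trigger bounds the broadcast errors with tolerance
          \<open>s = \<sigma> * exp (- \<iota> * t)\<close>.\<close>
        have "(\<Sum>i\<in>UNIV. mu i t \<bullet> g i t (ystar $ i)) - 2 * K\<^sub>\<mu> * (\<Sum>i\<in>UNIV. pen i) \<le> \<sigma> * exp (- \<iota> * t)"
          unfolding pen_def
        proof (rule penalty_dominates[OF graph mu_nonneg])
          show "(\<Sum>i\<in>UNIV. g i t (ystar $ i)) \<le> 0"
            using feas t by (simp add: feasible_set_def)
          show "norm (g i t (ystar $ i)) \<le> K\<^sub>g" for i
            using bounds(2)[OF t ystar] .
          show "norm (muhat i t - mu i t)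
            \<le> 1 / (6 * real CARD('N) * sqrt (real CARD('q)))
                * (\<Sum>j\<in>UNIV. adj E i j * norm1 (muhat i t - muhat j t))
              + \<sigma> * exp (- \<iota> * t) / (3 * (real CARD('N))\<^sup>2 * K\<^sub>\<mu> * sqrt (real CARD('q)))" for i
            using event_triggered_error_le[OF events abs_continuous_uniformly_continuous[OF trajectory(2)]
                params(3,4) K t, of i]
            by (simp add: trigger_threshold_def)
        qed (use params(7) K in auto)
        then have "\<epsilon> * ((\<Sum>i\<in>UNIV. mu i t \<bullet> g i t (ystar $ i)) - 2 * K\<^sub>\<mu> * (\<Sum>i\<in>UNIV. pen i))
            \<le> \<epsilon> * (\<sigma> * exp (- \<iota> * t))"
          using params(2) by (intro mult_left_mono) auto
        moreover have "(\<Sum>i\<in>UNIV. (X i t - ystar $ i) \<bullet> DX i t + mu i t \<bullet> Dmu i t)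
            \<le> (\<Sum>i\<in>UNIV. \<epsilon> * ((f i t (ystar $ i) - f i t (y t $ i) + mu i t \<bullet> g i t (ystar $ i)) - 2 * K\<^sub>\<mu> * pen i))"
          by (intro sum_mono agent)
        moreover have "\<dots> = \<epsilon> * (- F t) + \<epsilon> * ((\<Sum>i\<in>UNIV. mu i t \<bullet> g i t (ystar $ i)) - 2 * K\<^sub>\<mu> * (\<Sum>i\<in>UNIV. pen i))"
          by (simp add: F_def total_cost_def sum.distrib sum_subtractf sum_distrib_left sum_distrib_right algebra_simps)
        ultimately have "(\<Sum>i\<in>UNIV. (X i t - ystar $ i) \<bullet> DX i t + mu i t \<bullet> Dmu i t)
            \<le> \<epsilon> * (\<sigma> * exp (- \<iota> * t) - F t)"
          by (simp add: algebra_simps)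
        moreover have "(\<Sum>i\<in>UNIV. 2 * ((X i t - ystar $ i) \<bullet> DX i t) + 2 * ((mu i t - 0) \<bullet> Dmu i t))
            = 2 * (\<Sum>i\<in>UNIV. (X i t - ystar $ i) \<bullet> DX i t + mu i t \<bullet> Dmu i t)"
          by (simp add: sum_distrib_left)
        ultimately show "F t + (\<Sum>i\<in>UNIV. 2 * ((X i t - ystar $ i) \<bullet> DX i t) + 2 * ((mu i t - 0) \<bullet> Dmu i t)) / (2 * \<epsilon>)
            \<le> \<sigma> * exp (- \<iota> * t)"
          using params(2) by (simp add: field_simps)
      qed
    qed
  qed
  moreover have "((\<lambda>t. F t
        + (\<Sum>i\<in>UNIV. 2 * ((X i t - ystar $ i) \<bullet> DX i t) + 2 * ((mu i t - 0) \<bullet> Dmu i t)) / (2 * \<epsilon>))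
      has_integral integral {0..T} F
        + (\<Sum>i\<in>UNIV. ((norm (X i T - ystar $ i))\<^sup>2 - (norm (X i 0 - ystar $ i))\<^sup>2)
            + ((norm (mu i T - 0))\<^sup>2 - (norm (mu i 0 - 0))\<^sup>2)) / (2 * \<epsilon>)) {0..T}"
    by (intro has_integral_add has_integral_divide has_integral_sum F_integral X_integral mu_integral) auto
  moreover have "((\<lambda>t. \<sigma> * exp (- \<iota> * t)) has_integral \<sigma> / \<iota> * (1 - exp (- \<iota> * T))) {0..T}"
    using params(1,4) by (intro has_integral_exp_decay) auto
  ultimately have "integral {0..T} F
      + (\<Sum>i\<in>UNIV. ((norm (X i T - ystar $ i))\<^sup>2 - (norm (X i 0 - ystar $ i))\<^sup>2)
          + ((norm (mu i T - 0))\<^sup>2 - (norm (mu i 0 - 0))\<^sup>2)) / (2 * \<epsilon>)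
      \<le> \<sigma> / \<iota> * (1 - exp (- \<iota> * T))"
    by (intro has_integral_le_AE)
  moreover have "\<sigma> / \<iota> * (1 - exp (- \<iota> * T)) \<le> \<sigma> / \<iota> * 1"
    using params(3,4) by (intro mult_left_mono) auto
  \<comment> \<open>The multipliers start at 0 and the terminal squares are nonnegative, so only the
    initial output distances remain; they add up to the stacked norm.\<close>
  moreover have "- (norm (y 0 - ystar))\<^sup>2
      \<le> (\<Sum>i\<in>UNIV. ((norm (X i T - ystar $ i))\<^sup>2 - (norm (X i 0 - ystar $ i))\<^sup>2)
          + ((norm (mu i T - 0))\<^sup>2 - (norm (mu i 0 - 0))\<^sup>2))"
    unfolding norm_square_vec[of "y 0 - ystar"] sum_negf[symmetric]
    using params(1) by (intro sum_mono) (simp add: X trajectory(7))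
  then have "- (norm (y 0 - ystar))\<^sup>2 / (2 * \<epsilon>)
      \<le> (\<Sum>i\<in>UNIV. ((norm (X i T - ystar $ i))\<^sup>2 - (norm (X i 0 - ystar $ i))\<^sup>2)
          + ((norm (mu i T - 0))\<^sup>2 - (norm (mu i 0 - 0))\<^sup>2)) / (2 * \<epsilon>)"
    using params(2) by (intro divide_right_mono) auto
  ultimately have "integral {0..T} F \<le> (norm (y 0 - ystar))\<^sup>2 / (2 * \<epsilon>) + \<sigma> / \<iota>"
    by simp
  then show ?thesis by (simp add: F_def[abs_def])
qed

end
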